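(* For every $p\in(0,1)$ and every $(x^{(1)},x^{(2)})\in\mathbb{R}^D\times\mathbb{R}^D$, the pointwise error bound $$b^*_p(x^{(1)},x^{(2)})=\inf\big\{b\in\mathbb{R}:\mathbb{P}[\mathcal{E}(x^{(1)},x^{(2)})\le b]>p\big\}$$ of the error process $\mathcal{E}=\tilde f-f$ satisfies $$b^*_p(x^{(1)},x^{(2)})=\sigma_{\mathcal{E}}(x^{(1)},x^{(2)})\cdot Q(p),$$ where $\sigma_{\mathcal{E}}(x^{(1)},x^{(2)})$ is the standard deviation of $\mathcal{E}(x^{(1)},x^{(2)})$ and $Q$ is the quantile function of the standard normal distribution.
   Context: Let $D\ge 1$ and write points of $\mathbb{R}^D\times\mathbb{R}^D$ as $x=(x^{(1)},x^{(2)})$, with $x^{flip}=(x^{(2)},x^{(1)})$. A real-valued random field is Gaussian if every finite linear combination of its values is a (possibly degenerate) Gaussian random variable. Let $u$ be a mean-zero isotropic Gaussian field on $\mathbb{R}^D\times\mathbb{R}^D$ with covariance function $k_u(x,y)=h(\|x-y\|_2^2)$, where $h:[0,\infty)\to\mathbb{R}$. The field $f(x)=u(x)-u(x^{flip})$ is called a block isotropic Gaussian field with base field $u$; its covariance function is denoted $k_f$. Standing smoothness assumption: $k_u$ (hence $k_f$) is four times continuously differentiable, and $h$ is twice continuously differentiable on $[0,\infty)$. Derivatives of $f$ are taken in the mean-square ($L^2(\Omega)$) sense. Fix $z^*\in\mathbb{R}^D$ and $z=(z^*,z^* )$. Define $$g_i=\partial_{x^{(1)}_i}f(x)\big|_{x=z},\quad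 H^{(1,1)}_{i,j}=\partial_{x^{(1)}_i}\partial_{x^{(1)}_j}f(x)\big|_{x=z},\quad H^{(1,2)}_{i,j}=\partial_{x^{(1)}_i}\partial_{x^{(2)}_j}f(x)\big|_{x=z}.$$ The second-order (skew-symmetric) Taylor approximation of $f$ at $z$ is $$\tilde f(x)=g^{\mathsf T}(v-w)+\tfrac12\big(v^{\mathsf T}H^{(1,1)}v-w^{\mathsf T}H^{(1,1)}w\big)+v^{\mathsf T}H^{(1,2)}w,\qquad v=x^{(1)}-z^*,\ w=x^{(2)}-z^*.$$ *)

theory Defs
  imports "HOL-Probability.Probability"
begin

text \<open>
  \<open>k\<close> times continuously differentiable on the whole space.  In finite dimension it is
  equivalent to require this recursively of all directional derivatives.
\<close>
fun k_times_cont_diff :: "nat \<Rightarrow> ('a::euclidean_space \<Rightarrow> real) \<Rightarrow> bool" where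
  "k_times_cont_diff 0 F \<longleftrightarrow> continuous_on UNIV F"
| "k_times_cont_diff (Suc k) F \<longleftrightarrow>
     (\<forall>x. F differentiable (at x)) \<and>
     (\<forall>v. k_times_cont_diff k (\<lambda>x. frechet_derivative F (at x) v))"

text \<open>Twice continuously differentiable on \<open>{0..}\<close>, with one-sided derivatives at \<open>0\<close>;
  the values of \<open>h\<close> at negative arguments are irrelevant.\<close>
definition C2_on_nonneg :: "(real \<Rightarrow> real) \<Rightarrow> bool" where
  "C2_on_nonneg h \<longleftrightarrow>
     (\<exists>h' h''. (\<forall>t\<ge>0. (h has_real_derivative h' t) (at t within {0..})) \<and>
               (\<forall>t\<ge>0. (h' has_real_derivative h'' t) (at t within {0..})) \<and>
               continuous_on {0..} h'')"

definition gaussian_rv :: "'w measure \<Rightarrow> ('w \<Rightarrow> real) \<Rightarrow> bool" where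
  "gaussian_rv M X \<longleftrightarrow>
     X \<in> borel_measurable M \<and>
     ((\<exists>c. AE \<omega> in M. X \<omega> = c) \<or>
      (\<exists>\<mu> \<sigma>. \<sigma> > 0 \<and> distributed M lborel X (normal_density \<mu> \<sigma>)))"

definition gaussian_field :: "'w measure \<Rightarrow> ('a \<Rightarrow> 'w \<Rightarrow> real) \<Rightarrow> bool" where
  "gaussian_field M u \<longleftrightarrow>
     (\<forall>S c. finite S \<longrightarrow> gaussian_rv M (\<lambda>\<omega>. \<Sum>x\<in>S. c x * u x \<omega>))"

definition mean_zero_field :: "'w measure \<Rightarrow> ('a \<Rightarrow> 'w \<Rightarrow> real) \<Rightarrow> bool" where
  "mean_zero_field M u \<longleftrightarrow> (\<forall>x. integral\<^sup>L M (u x) = 0)"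

definition cov_fun :: "'w measure \<Rightarrow> ('a \<Rightarrow> 'w \<Rightarrow> real) \<Rightarrow> 'a \<times> 'a \<Rightarrow> real" where
  "cov_fun M u = (\<lambda>(x, y).
     integral\<^sup>L M (\<lambda>\<omega>. (u x \<omega> - integral\<^sup>L M (u x)) * (u y \<omega> - integral\<^sup>L M (u y))))"

definition std_dev :: "'w measure \<Rightarrow> ('w \<Rightarrow> real) \<Rightarrow> real" where
  "std_dev M X = sqrt (integral\<^sup>L M (\<lambda>\<omega>. (X \<omega> - integral\<^sup>L M X)\<^sup>2))"

definition block_field :: "('a \<times> 'a \<Rightarrow> 'w \<Rightarrow> real) \<Rightarrow> 'a \<times> 'a \<Rightarrow> 'w \<Rightarrow> real" where
  "block_field u x \<omega> = u x \<omega> - u (prod.swap x) \<omega>"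

definition L2_rv :: "'w measure \<Rightarrow> ('w \<Rightarrow> real) set" where
  "L2_rv M = {X \<in> borel_measurable M. integrable M (\<lambda>\<omega>. (X \<omega>)\<^sup>2)}"

definition has_ms_deriv ::
    "'w measure \<Rightarrow> ('a::real_normed_vector \<Rightarrow> 'w \<Rightarrow> real) \<Rightarrow> 'a \<Rightarrow> 'a \<Rightarrow> ('w \<Rightarrow> real) \<Rightarrow> bool" where
  "has_ms_deriv M F e x G \<longleftrightarrow>
     (\<forall>y. F y \<in> L2_rv M) \<and> G \<in> L2_rv M \<and>
     ((\<lambda>t. integral\<^sup>L M (\<lambda>\<omega>. ((F (x + t *\<^sub>R e) \<omega> - F x \<omega>) / t - G \<omega>)\<^sup>2)) \<longlongrightarrow> 0) (at 0)"

text \<open>The mean-square derivative of \<open>F\<close> at \<open>x\<close> in direction \<open>e\<close>.  It is determined only up to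
  almost sure equality, so a version is chosen.\<close>
definition ms_deriv ::
    "'w measure \<Rightarrow> ('a::real_normed_vector \<Rightarrow> 'w \<Rightarrow> real) \<Rightarrow> 'a \<Rightarrow> 'a \<Rightarrow> 'w \<Rightarrow> real" where
  "ms_deriv M F e x = (SOME G. has_ms_deriv M F e x G)"

definition dir1 :: "'d::finite \<Rightarrow> (real^'d) \<times> (real^'d)" where
  "dir1 i = (axis i 1, 0)"

definition dir2 :: "'d::finite \<Rightarrow> (real^'d) \<times> (real^'d)" where
  "dir2 i = (0, axis i 1)"

context
  fixes M :: "'w measure"
    and f :: "(real^'d::finite) \<times> (real^'d) \<Rightarrow> 'w \<Rightarrow> real"
    and zs :: "real^'d"
begin

definition taylor_grad :: "'w \<Rightarrow> real^'d" where
  "taylor_grad \<omega> = (\<chi> i. ms_deriv M f (dir1 i) (zs, zs) \<omega>)"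

definition taylor_H11 :: "'w \<Rightarrow> real^'d^'d" where
  "taylor_H11 \<omega> =
     (\<chi> i j. ms_deriv M (\<lambda>x. ms_deriv M f (dir1 j) x) (dir1 i) (zs, zs) \<omega>)"

definition taylor_H12 :: "'w \<Rightarrow> real^'d^'d" where
  "taylor_H12 \<omega> =
     (\<chi> i j. ms_deriv M (\<lambda>x. ms_deriv M f (dir2 j) x) (dir1 i) (zs, zs) \<omega>)"

definition taylor2 :: "(real^'d) \<times> (real^'d) \<Rightarrow> 'w \<Rightarrow> real" where
  "taylor2 x \<omega> =
     (let v = fst x - zs; w = snd x - zs in
        taylor_grad \<omega> \<bullet> (v - w)
        + 1/2 * (v \<bullet> (taylor_H11 \<omega> *v v) - w \<bullet> (taylor_H11 \<omega> *v w))
        + v \<bullet> (taylor_H12 \<omega> *v w))"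

definition error_process :: "(real^'d) \<times> (real^'d) \<Rightarrow> 'w \<Rightarrow> real" where
  "error_process x \<omega> = taylor2 x \<omega> - f x \<omega>"

end

definition error_bound :: "'w measure \<Rightarrow> real \<Rightarrow> ('w \<Rightarrow> real) \<Rightarrow> real" where
  "error_bound M p E = Inf {b. measure M {\<omega> \<in> space M. E \<omega> \<le> b} > p}"

definition quantile_function :: "real measure \<Rightarrow> real \<Rightarrow> real" where
  "quantile_function N p = Inf {q. p \<le> cdf N q}"

end

theory Submission
  imports Defs
begin

text \<open>
  The error \<open>E\<close> at a point is a finite linear combination of values and mean-square
  derivatives of the field, hence an \<open>L\<^sup>2\<close> limit of finite linear combinations of values of \<open>u\<close>.
  The latter are centered Gaussian variables, and this class is closed in \<open>L\<^sup>2\<close>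
  (\<open>centered_gaussian_L2_limit\<close>): along an \<open>L\<^sup>2\<close> limit the characteristic functions converge
  pointwise and the variances converge, so the limit still has characteristic function
  \<open>exp (- t\<^sup>2 \<sigma>\<^sup>2 / 2)\<close>.  By Levy's uniqueness theorem \<open>E\<close> is then distributed as \<open>\<sigma>\<close> times a
  standard normal variable, and its \<open>p\<close>-quantile is \<open>\<sigma>\<close> times the standard normal one.

  The substantial point is that the mean-square derivatives exist at all, since otherwise the
  Taylor coefficients would be arbitrary functions.  For a second-order field \<open>F\<close> the inner
  product of two difference quotients in direction \<open>e\<close> is a mixed second difference quotient of
  \<open>K (x, y) = E[F x F y]\<close>.  When \<open>K\<close> is twice continuously differentiable, it converges to the
  mixed derivative of \<open>K\<close> as both increments tend to \<open>0\<close> independently.  Therefore the difference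
  quotients are Cauchy in \<open>L\<^sup>2\<close>, and they converge by completeness (\<open>L2_complete\<close>,
  \<open>ms_deriv_exists\<close>).  The same computation identifies the product moments of the derivative
  field with that mixed derivative (\<open>product_moment_ms_deriv\<close>), so that a kernel of class
  \<open>C\<^sup>4\<close> leaves a kernel of class \<open>C\<^sup>2\<close> for the derivative field and the argument can be repeated to
  obtain the second derivatives.
\<close>

section \<open>Square-integrable random variables\<close>

lemma L2_rvD:
  assumes "X \<in> L2_rv M"
  shows "X \<in> borel_measurable M" "integrable M (\<lambda>\<omega>. (X \<omega>)\<^sup>2)"
  using assms by (auto simp: L2_rv_def)

lemma integrable_mult_L2:
  assumes "X \<in> L2_rv M" "Y \<in> L2_rv M"
  shows "integrable M (\<lambda>\<omega>. X \<omega> * Y \<omega>)"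
proof (rule Bochner_Integration.integrable_bound)
  show "integrable M (\<lambda>\<omega>. (X \<omega>)\<^sup>2 + (Y \<omega>)\<^sup>2)"
    using assms by (intro Bochner_Integration.integrable_add L2_rvD)
  show "(\<lambda>\<omega>. X \<omega> * Y \<omega>) \<in> borel_measurable M"
    using assms[THEN L2_rvD(1)] by measurable
  have "\<bar>a * b\<bar> \<le> a\<^sup>2 + b\<^sup>2" for a b :: real
    using sum_squares_bound[of a b] sum_squares_bound[of a "- b"]
      zero_le_power2[of a] zero_le_power2[of b] unfolding abs_le_iff power2_minus by linarith
  then show "AE \<omega> in M. norm (X \<omega> * Y \<omega>) \<le> norm ((X \<omega>)\<^sup>2 + (Y \<omega>)\<^sup>2)"
    by auto
qed

lemma L2_rv_cmult: "X \<in> L2_rv M \<Longrightarrow> (\<lambda>\<omega>. c * X \<omega>) \<in> L2_rv M"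
  by (auto simp: L2_rv_def power_mult_distrib)

lemma L2_rv_add:
  assumes "X \<in> L2_rv M" "Y \<in> L2_rv M"
  shows "(\<lambda>\<omega>. X \<omega> + Y \<omega>) \<in> L2_rv M"
  using assms integrable_mult_L2[OF assms] by (auto simp: L2_rv_def power2_sum mult.assoc)

lemma L2_rv_diff:
  assumes "X \<in> L2_rv M" "Y \<in> L2_rv M"
  shows "(\<lambda>\<omega>. X \<omega> - Y \<omega>) \<in> L2_rv M"
  using assms integrable_mult_L2[OF assms] by (auto simp: L2_rv_def power2_diff mult.assoc)

lemma L2_rv_divide: "X \<in> L2_rv M \<Longrightarrow> (\<lambda>\<omega>. X \<omega> / c) \<in> L2_rv M"
  using L2_rv_cmult[of X M "inverse c"] by (simp add: field_simps)

text \<open>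
  The usual discriminant argument: \<open>E (t X + s Y)\<^sup>2\<close> is a nonnegative quadratic form in \<open>(t, s)\<close>.
\<close>
lemma L2_Cauchy_Schwarz:
  assumes X: "X \<in> L2_rv M" and Y: "Y \<in> L2_rv M"
  shows "\<bar>\<integral>\<omega>. X \<omega> * Y \<omega> \<partial>M\<bar> \<le> sqrt (\<integral>\<omega>. (X \<omega>)\<^sup>2 \<partial>M) * sqrt (\<integral>\<omega>. (Y \<omega>)\<^sup>2 \<partial>M)"
proof -
  define a b c where "a = (\<integral>\<omega>. (X \<omega>)\<^sup>2 \<partial>M)" and "b = (\<integral>\<omega>. (Y \<omega>)\<^sup>2 \<partial>M)"
    and "c = (\<integral>\<omega>. X \<omega> * Y \<omega> \<partial>M)"
  have ab: "a \<ge> 0" "b \<ge> 0" by (auto simp: a_def b_def)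
  have q: "0 \<le> a * t\<^sup>2 + 2 * s * t * c + s\<^sup>2 * b" for s t
  proof -
    have "0 \<le> (\<integral>\<omega>. (t * X \<omega> + s * Y \<omega>)\<^sup>2 \<partial>M)" by simp
    also have "\<dots> = (\<integral>\<omega>. t\<^sup>2 * (X \<omega>)\<^sup>2 + (2 * s * t) * (X \<omega> * Y \<omega>) + s\<^sup>2 * (Y \<omega>)\<^sup>2 \<partial>M)"
      by (rule Bochner_Integration.integral_cong) (auto simp: power2_eq_square algebra_simps)
    also have "\<dots> = a * t\<^sup>2 + 2 * s * t * c + s\<^sup>2 * b"
      using L2_rvD(2)[OF X] L2_rvD(2)[OF Y] integrable_mult_L2[OF X Y]
      by (simp add: a_def b_def c_def)
    finally show ?thesis .
  qed
  have "c\<^sup>2 \<le> a * b"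
  proof (cases "b = 0")
    case True
    show ?thesis
    proof (rule ccontr)
      assume "\<not> c\<^sup>2 \<le> a * b"
      then have c: "c \<noteq> 0" using True by auto
      \<comment> \<open>If \<open>Y\<close> has norm \<open>0\<close>, the form is affine in \<open>s\<close> and this \<open>s\<close> gives it the value \<open>-1\<close>.\<close>
      from q[where t = 1 and s = "- (a + 1) / (2 * c)"] True c show False
        by (simp add: field_simps)
    qed
  next
    case False
    then have "b > 0" using ab by simp
    have "0 \<le> b * (a * b - c\<^sup>2)"
      using q[where t = b and s = "- c"] by (simp add: power2_eq_square algebra_simps)
    then show ?thesis using \<open>b > 0\<close> by (simp add: zero_le_mult_iff)
  qed
  then have "\<bar>c\<bar> \<le> sqrt (a * b)"
    by (metis real_sqrt_abs real_sqrt_le_mono)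
  then show ?thesis by (simp add: a_def b_def c_def real_sqrt_mult)
qed

lemma (in prob_space) integrable_L2:
  assumes "X \<in> L2_rv M" shows "integrable M X"
proof -
  have "(\<lambda>\<omega>. 1) \<in> L2_rv M" by (auto simp: L2_rv_def)
  from integrable_mult_L2[OF assms this] show ?thesis by simp
qed

lemma (in prob_space) L1_le_L2:
  assumes "X \<in> L2_rv M"
  shows "(\<integral>\<omega>. \<bar>X \<omega>\<bar> \<partial>M) \<le> sqrt (\<integral>\<omega>. (X \<omega>)\<^sup>2 \<partial>M)"
proof -
  have *: "(\<lambda>\<omega>. 1) \<in> L2_rv M" "(\<lambda>\<omega>. \<bar>X \<omega>\<bar>) \<in> L2_rv M"
    using assms by (auto simp: L2_rv_def)
  show ?thesis using L2_Cauchy_Schwarz[OF *(2,1)] by (simp add: prob_space)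
qed

definition L2_conv :: "'w measure \<Rightarrow> ('i \<Rightarrow> 'w \<Rightarrow> real) \<Rightarrow> ('w \<Rightarrow> real) \<Rightarrow> 'i filter \<Rightarrow> bool" where
  "L2_conv M X Y F \<longleftrightarrow> (\<forall>i. X i \<in> L2_rv M) \<and> Y \<in> L2_rv M \<and>
     ((\<lambda>i. \<integral>\<omega>. (X i \<omega> - Y \<omega>)\<^sup>2 \<partial>M) \<longlongrightarrow> 0) F"

text \<open>
  A quasi-triangle inequality for the squared distance.  The factor \<open>2\<close> is harmless in limit
  arguments and avoids square roots.
\<close>
lemma L2_dist_triangle:
  assumes "X \<in> L2_rv M" "Y \<in> L2_rv M" "Z \<in> L2_rv M"
  shows "(\<integral>\<omega>. (X \<omega> - Z \<omega>)\<^sup>2 \<partial>M) \<le> 2 * (\<integral>\<omega>. (X \<omega> - Y \<omega>)\<^sup>2 \<partial>M) + 2 * (\<integral>\<omega>. (Y \<omega> - Z \<omega>)\<^sup>2 \<partial>M)"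
proof -
  have i: "integrable M (\<lambda>\<omega>. (X \<omega> - Y \<omega>)\<^sup>2)" "integrable M (\<lambda>\<omega>. (Y \<omega> - Z \<omega>)\<^sup>2)"
    "integrable M (\<lambda>\<omega>. (X \<omega> - Z \<omega>)\<^sup>2)"
    using assms by (auto intro!: L2_rvD L2_rv_diff)
  have "(a - c)\<^sup>2 \<le> 2 * (a - b)\<^sup>2 + 2 * (b - c)\<^sup>2" for a b c :: real
    using zero_le_power2[of "(a - b) - (b - c)"] by (simp add: power2_eq_square algebra_simps)
  then have "(\<integral>\<omega>. (X \<omega> - Z \<omega>)\<^sup>2 \<partial>M) \<le> (\<integral>\<omega>. 2 * (X \<omega> - Y \<omega>)\<^sup>2 + 2 * (Y \<omega> - Z \<omega>)\<^sup>2 \<partial>M)"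
    using i by (intro integral_mono) auto
  then show ?thesis using i by simp
qed

text \<open>
  Joint continuity of the inner product.  It yields convergence of norms, of means (paired with the
  constant \<open>1\<close>), and of the product moments of difference quotients.
\<close>
lemma L2_conv_inner:
  assumes X: "L2_conv M X x F" and Y: "L2_conv M Y y F"
  shows "((\<lambda>i. \<integral>\<omega>. X i \<omega> * Y i \<omega> \<partial>M) \<longlongrightarrow> (\<integral>\<omega>. x \<omega> * y \<omega> \<partial>M)) F"
proof -
  note L = assms[unfolded L2_conv_def]
  have L2: "X i \<in> L2_rv M" "Y i \<in> L2_rv M" "x \<in> L2_rv M" "y \<in> L2_rv M"
    "(\<lambda>\<omega>. X i \<omega> - x \<omega>) \<in> L2_rv M" "(\<lambda>\<omega>. Y i \<omega> - y \<omega>) \<in> L2_rv M" for i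
    using L by (auto intro: L2_rv_diff)
  let ?a = "\<lambda>i. sqrt (\<integral>\<omega>. (X i \<omega> - x \<omega>)\<^sup>2 \<partial>M)" and ?b = "\<lambda>i. sqrt (\<integral>\<omega>. (Y i \<omega> - y \<omega>)\<^sup>2 \<partial>M)"
  let ?x = "sqrt (\<integral>\<omega>. (x \<omega>)\<^sup>2 \<partial>M)" and ?y = "sqrt (\<integral>\<omega>. (y \<omega>)\<^sup>2 \<partial>M)"
  have ab: "(?a \<longlongrightarrow> 0) F" "(?b \<longlongrightarrow> 0) F"
    using tendsto_real_sqrt[of _ 0 F] L by auto
  have "\<bar>(\<integral>\<omega>. X i \<omega> * Y i \<omega> \<partial>M) - (\<integral>\<omega>. x \<omega> * y \<omega> \<partial>M)\<bar> \<le> ?a i * ?b i + ?a i * ?y + ?x * ?b i" for i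
  proof -
    have "(\<integral>\<omega>. X i \<omega> * Y i \<omega> \<partial>M) =
        (\<integral>\<omega>. (X i \<omega> - x \<omega>) * (Y i \<omega> - y \<omega>) + (X i \<omega> - x \<omega>) * y \<omega> + x \<omega> * (Y i \<omega> - y \<omega>) + x \<omega> * y \<omega> \<partial>M)"
      by (rule Bochner_Integration.integral_cong) (auto simp: algebra_simps)
    also have "\<dots> = (\<integral>\<omega>. (X i \<omega> - x \<omega>) * (Y i \<omega> - y \<omega>) \<partial>M) + (\<integral>\<omega>. (X i \<omega> - x \<omega>) * y \<omega> \<partial>M)
        + (\<integral>\<omega>. x \<omega> * (Y i \<omega> - y \<omega>) \<partial>M) + (\<integral>\<omega>. x \<omega> * y \<omega> \<partial>M)"
      by (simp add: integrable_mult_L2[OF L2(5) L2(6)] integrable_mult_L2[OF L2(5) L2(4)]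
          integrable_mult_L2[OF L2(3) L2(6)] integrable_mult_L2[OF L2(3) L2(4)])
    finally show ?thesis
      using L2_Cauchy_Schwarz[OF L2(5) L2(6), of i i] L2_Cauchy_Schwarz[OF L2(5) L2(4), of i]
        L2_Cauchy_Schwarz[OF L2(3) L2(6), of i] by linarith
  qed
  then have "\<forall>\<^sub>F i in F. norm ((\<integral>\<omega>. X i \<omega> * Y i \<omega> \<partial>M) - (\<integral>\<omega>. x \<omega> * y \<omega> \<partial>M))
      \<le> ?a i * ?b i + ?a i * ?y + ?x * ?b i"
    by (intro always_eventually allI) (simp only: real_norm_def)
  moreover have "((\<lambda>i. ?a i * ?b i + ?a i * ?y + ?x * ?b i) \<longlongrightarrow> 0) F"
    using tendsto_add[OF tendsto_add[OF tendsto_mult[OF ab] tendsto_mult_left[OF ab(1), of ?y]]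
        tendsto_mult_right[OF ab(2), of ?x]] by (simp add: mult.commute)
  ultimately have "((\<lambda>i. (\<integral>\<omega>. X i \<omega> * Y i \<omega> \<partial>M) - (\<integral>\<omega>. x \<omega> * y \<omega> \<partial>M)) \<longlongrightarrow> 0) F"
    by (rule Lim_null_comparison)
  then show ?thesis using LIM_zero_iff by blast
qed

text \<open>
  Riesz-Fischer.  A subsequence whose consecutive distances decay geometrically converges almost
  surely, because its increments have summable \<open>L\<^sup>1\<close> norms; Fatou's lemma upgrades the
  almost sure limit to an \<open>L\<^sup>2\<close> limit of the whole sequence.
\<close>
lemma (in prob_space) L2_complete:
  fixes X :: "nat \<Rightarrow> 'a \<Rightarrow> real"
  assumes X: "\<And>n. X n \<in> L2_rv M"
    and Cauchy: "\<And>\<epsilon>. \<epsilon> > 0 \<Longrightarrow> \<exists>N. \<forall>m\<ge>N. \<forall>n\<ge>N. (\<integral>\<omega>. (X m \<omega> - X n \<omega>)\<^sup>2 \<partial>M) < \<epsilon>"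
  shows "\<exists>G. L2_conv M X G sequentially"
proof -
  have [measurable]: "X n \<in> borel_measurable M" for n using L2_rvD(1)[OF X] .
  have "\<forall>k. \<exists>N. \<forall>m\<ge>N. \<forall>n\<ge>N. (\<integral>\<omega>. (X m \<omega> - X n \<omega>)\<^sup>2 \<partial>M) < (1/4)^k"
    using Cauchy by simp
  then obtain K where K: "\<And>k m n. m \<ge> K k \<Longrightarrow> n \<ge> K k \<Longrightarrow> (\<integral>\<omega>. (X m \<omega> - X n \<omega>)\<^sup>2 \<partial>M) < (1/4)^k"
    by metis
  \<comment> \<open>The sum makes both \<open>r k\<close> and \<open>r (Suc k)\<close> at least \<open>K k\<close>; the summand \<open>k\<close> makes \<open>r\<close> unbounded.\<close>
  define r where "r k = k + (\<Sum>i\<le>k. K i)" for k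
  have rK: "r k \<ge> K k" for k
  proof -
    have "K k \<le> (\<Sum>i\<le>k. K i)" by (rule member_le_sum) auto
    then show ?thesis by (simp add: r_def)
  qed
  have r: "r (Suc k) \<ge> K k" for k
    using rK[of k] by (simp add: r_def)
  have rk: "r k \<ge> k" for k by (simp add: r_def)
  define Z where "Z k \<omega> = X (r (Suc k)) \<omega> - X (r k) \<omega>" for k \<omega>
  have Z2: "Z k \<in> L2_rv M" for k
    unfolding Z_def by (intro L2_rv_diff X)
  have [measurable]: "Z k \<in> borel_measurable M" for k using L2_rvD(1)[OF Z2] .
  have Zle: "(\<integral>\<omega>. \<bar>Z k \<omega>\<bar> \<partial>M) \<le> (1/2)^k" for k
  proof -
    have "(\<integral>\<omega>. \<bar>Z k \<omega>\<bar> \<partial>M) \<le> sqrt (\<integral>\<omega>. (Z k \<omega>)\<^sup>2 \<partial>M)" by (rule L1_le_L2[OF Z2])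
    also have "\<dots> \<le> sqrt ((1/4)^k)"
      using K[OF r rK, of k] by (auto simp: Z_def)
    also have "\<dots> = (1/2)^k"
      by (simp add: real_sqrt_power real_sqrt_divide)
    finally show ?thesis .
  qed
  have "(\<integral>\<^sup>+\<omega>. (\<Sum>k. ennreal \<bar>Z k \<omega>\<bar>) \<partial>M) = (\<Sum>k. \<integral>\<^sup>+\<omega>. ennreal \<bar>Z k \<omega>\<bar> \<partial>M)"
    by (rule nn_integral_suminf) simp
  also have "\<dots> \<le> (\<Sum>k. ennreal ((1/2)^k))"
  proof (rule suminf_le)
    fix k
    have "(\<integral>\<^sup>+\<omega>. ennreal \<bar>Z k \<omega>\<bar> \<partial>M) = ennreal (\<integral>\<omega>. \<bar>Z k \<omega>\<bar> \<partial>M)"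
      using integrable_L2[OF Z2] by (intro nn_integral_eq_integral) auto
    then show "(\<integral>\<^sup>+\<omega>. ennreal \<bar>Z k \<omega>\<bar> \<partial>M) \<le> ennreal ((1/2)^k)"
      using Zle[of k] by (simp add: ennreal_leI)
  qed auto
  also have "\<dots> < \<infinity>"
    by (subst suminf_ennreal2) (auto simp: summable_geometric)
  finally have "AE \<omega> in M. (\<Sum>k. ennreal \<bar>Z k \<omega>\<bar>) \<noteq> \<infinity>"
    by (intro nn_integral_PInf_AE) auto
  then have conv: "AE \<omega> in M. (\<lambda>k. X (r k) \<omega>) \<longlonglongrightarrow> lim (\<lambda>k. X (r k) \<omega>)"
  proof eventually_elim
    case (elim \<omega>)
    then have "summable (\<lambda>k. \<bar>Z k \<omega>\<bar>)"
      by (intro summable_suminf_not_top) auto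
    then have "summable (\<lambda>k. Z k \<omega>)" by (rule summable_rabs_cancel)
    then have "convergent (\<lambda>n. (\<Sum>k<n. Z k \<omega>) + X (r 0) \<omega>)"
      by (intro convergent_add convergent_const) (simp add: summable_iff_convergent)
    moreover have "(\<Sum>k<n. Z k \<omega>) + X (r 0) \<omega> = X (r n) \<omega>" for n
      unfolding Z_def using sum_lessThan_telescope[of "\<lambda>k. X (r k) \<omega>" n] by simp
    ultimately show ?case by (simp add: convergent_LIMSEQ_iff)
  qed
  define G where "G \<omega> = lim (\<lambda>k. X (r k) \<omega>)" for \<omega>
  have [measurable]: "G \<in> borel_measurable M" unfolding G_def by measurable
  have fatou: "(\<integral>\<^sup>+\<omega>. ennreal ((X m \<omega> - G \<omega>)\<^sup>2) \<partial>M) \<le> ennreal \<epsilon>"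
    if N: "\<And>n. n \<ge> N \<Longrightarrow> (\<integral>\<omega>. (X m \<omega> - X n \<omega>)\<^sup>2 \<partial>M) < \<epsilon>" for m N \<epsilon>
  proof -
    have "(\<integral>\<^sup>+\<omega>. ennreal ((X m \<omega> - G \<omega>)\<^sup>2) \<partial>M) = (\<integral>\<^sup>+\<omega>. liminf (\<lambda>k. ennreal ((X m \<omega> - X (r k) \<omega>)\<^sup>2)) \<partial>M)"
    proof (rule nn_integral_cong_AE)
      from conv show "AE \<omega> in M. ennreal ((X m \<omega> - G \<omega>)\<^sup>2) = liminf (\<lambda>k. ennreal ((X m \<omega> - X (r k) \<omega>)\<^sup>2))"
      proof eventually_elim
        case (elim \<omega>)
        then have "(\<lambda>k. ennreal ((X m \<omega> - X (r k) \<omega>)\<^sup>2)) \<longlonglongrightarrow> ennreal ((X m \<omega> - G \<omega>)\<^sup>2)"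
          unfolding G_def by (intro tendsto_intros tendsto_ennrealI)
        then show ?case using lim_imp_Liminf[OF trivial_limit_sequentially] by metis
      qed
    qed
    also have "\<dots> \<le> liminf (\<lambda>k. \<integral>\<^sup>+\<omega>. ennreal ((X m \<omega> - X (r k) \<omega>)\<^sup>2) \<partial>M)"
      by (rule nn_integral_liminf) auto
    also have "\<dots> \<le> liminf (\<lambda>k. ennreal \<epsilon>)"
    proof (rule Liminf_mono, rule eventually_sequentiallyI[of N])
      fix k assume "k \<ge> N"
      then have "r k \<ge> N" using rk[of k] by simp
      have "(\<integral>\<^sup>+\<omega>. ennreal ((X m \<omega> - X (r k) \<omega>)\<^sup>2) \<partial>M) = ennreal (\<integral>\<omega>. (X m \<omega> - X (r k) \<omega>)\<^sup>2 \<partial>M)"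
        by (intro nn_integral_eq_integral L2_rvD L2_rv_diff X) auto
      then show "(\<integral>\<^sup>+\<omega>. ennreal ((X m \<omega> - X (r k) \<omega>)\<^sup>2) \<partial>M) \<le> ennreal \<epsilon>"
        using N[OF \<open>r k \<ge> N\<close>] by (simp add: ennreal_leI)
    qed
    also have "\<dots> = ennreal \<epsilon>" by (simp add: Liminf_const)
    finally show ?thesis .
  qed
  have diff2: "(\<lambda>\<omega>. X m \<omega> - G \<omega>) \<in> L2_rv M \<and> (\<integral>\<omega>. (X m \<omega> - G \<omega>)\<^sup>2 \<partial>M) \<le> \<epsilon>"
    if "\<And>n. n \<ge> N \<Longrightarrow> (\<integral>\<omega>. (X m \<omega> - X n \<omega>)\<^sup>2 \<partial>M) < \<epsilon>" "\<epsilon> > 0" for m N \<epsilon>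
  proof -
    note f = fatou[OF that(1), of N, simplified]
    have i: "integrable M (\<lambda>\<omega>. (X m \<omega> - G \<omega>)\<^sup>2)"
      using f by (intro integrableI_bounded) (auto intro: order.strict_trans1)
    then have "ennreal (\<integral>\<omega>. (X m \<omega> - G \<omega>)\<^sup>2 \<partial>M) \<le> ennreal \<epsilon>"
      using f by (subst nn_integral_eq_integral[symmetric]) auto
    then show ?thesis using i that(2) by (auto simp: L2_rv_def)
  qed
  have "G \<in> L2_rv M"
  proof -
    have "(\<lambda>\<omega>. X (K 0) \<omega> - G \<omega>) \<in> L2_rv M"
      using diff2[of "K 0" "K 0" 1] K[of 0] by auto
    from L2_rv_diff[OF X[of "K 0"] this] show ?thesis by simp
  qed
  moreover have "(\<lambda>m. \<integral>\<omega>. (X m \<omega> - G \<omega>)\<^sup>2 \<partial>M) \<longlonglongrightarrow> 0"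
  proof (rule LIMSEQ_I)
    fix \<epsilon> :: real assume "\<epsilon> > 0"
    then obtain N where N: "\<forall>m\<ge>N. \<forall>n\<ge>N. (\<integral>\<omega>. (X m \<omega> - X n \<omega>)\<^sup>2 \<partial>M) < \<epsilon> / 2"
      using Cauchy[of "\<epsilon> / 2"] by auto
    have "(\<integral>\<omega>. (X m \<omega> - G \<omega>)\<^sup>2 \<partial>M) < \<epsilon>" if "m \<ge> N" for m
    proof -
      have "(\<integral>\<omega>. (X m \<omega> - G \<omega>)\<^sup>2 \<partial>M) \<le> \<epsilon> / 2"
        using diff2[of N m "\<epsilon> / 2"] N that \<open>\<epsilon> > 0\<close> by auto
      with \<open>\<epsilon> > 0\<close> show ?thesis by linarith
    qed
    then show "\<exists>N. \<forall>m\<ge>N. norm ((\<integral>\<omega>. (X m \<omega> - G \<omega>)\<^sup>2 \<partial>M) - 0) < \<epsilon>"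
      by (intro exI[of _ N]) auto
  qed
  ultimately show ?thesis using X by (auto simp: L2_conv_def)
qed

section \<open>Mean-square differentiability from the product moments\<close>

lemma mvt_from_0:
  fixes \<phi> \<phi>' :: "real \<Rightarrow> real"
  assumes "\<And>a. (\<phi> has_real_derivative \<phi>' a) (at a)"
  shows "\<exists>\<xi>. \<bar>\<xi>\<bar> \<le> \<bar>t\<bar> \<and> \<phi> t - \<phi> 0 = t * \<phi>' \<xi>"
proof -
  consider "t = 0" | "0 < t" | "t < 0" by linarith
  then show ?thesis
  proof cases
    case 1
    then show ?thesis by (intro exI[of _ 0]) simp
  next
    case 2
    then obtain z where "0 < z" "z < t" "\<phi> t - \<phi> 0 = (t - 0) * \<phi>' z"
      using MVT2[of 0 t \<phi> \<phi>'] assms by blast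
    then show ?thesis by (intro exI[of _ z]) auto
  next
    case 3
    then obtain z where "t < z" "z < 0" "\<phi> 0 - \<phi> t = (0 - t) * \<phi>' z"
      using MVT2[of t 0 \<phi> \<phi>'] assms by blast
    then show ?thesis by (intro exI[of _ z]) auto
  qed
qed

lemma has_real_derivative_along_line:
  fixes F :: "'a::real_normed_vector \<Rightarrow> real"
  assumes "F differentiable (at (p + a *\<^sub>R v))"
  shows "((\<lambda>a. F (p + a *\<^sub>R v)) has_real_derivative frechet_derivative F (at (p + a *\<^sub>R v)) v) (at a)"
proof -
  let ?D = "frechet_derivative F (at (p + a *\<^sub>R v))"
  have F: "(F has_derivative ?D) (at (p + a *\<^sub>R v))"
    using assms by (simp add: frechet_derivative_works)
  have "((\<lambda>a. p + a *\<^sub>R v) has_derivative (\<lambda>h. h *\<^sub>R v)) (at a)"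
    by (auto intro!: derivative_eq_intros)
  from has_derivative_compose[OF this F]
  have "((\<lambda>a. F (p + a *\<^sub>R v)) has_derivative (\<lambda>h. ?D (h *\<^sub>R v))) (at a)" .
  moreover have "(\<lambda>h. ?D (h *\<^sub>R v)) = (*) (?D v)"
    using linear_scale[OF has_derivative_linear[OF F]] by (auto simp: fun_eq_iff)
  ultimately show ?thesis by (simp add: has_field_derivative_def)
qed

text \<open>
  The derivative \<open>\<partial>\<^sub>e\<close> in the first argument followed by \<open>\<partial>\<^sub>e\<close> in the second.
\<close>
definition mixed_deriv :: "'a \<Rightarrow> ('a::euclidean_space \<times> 'a \<Rightarrow> real) \<Rightarrow> 'a \<times> 'a \<Rightarrow> real" where
  "mixed_deriv e K p =
     frechet_derivative (\<lambda>q. frechet_derivative K (at q) (e, 0)) (at p) (0, e)"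

definition diff_quot :: "('a::real_normed_vector \<Rightarrow> 'w \<Rightarrow> real) \<Rightarrow> 'a \<Rightarrow> 'a \<Rightarrow> real \<Rightarrow> 'w \<Rightarrow> real" where
  "diff_quot F e x t \<omega> = (F (x + t *\<^sub>R e) \<omega> - F x \<omega>) / t"

text \<open>
  The covariance function when the field is centered.  Means are not subtracted, because
  mean-square differentiability is a statement about the uncentered inner product.
\<close>
definition product_moment :: "'w measure \<Rightarrow> ('a \<Rightarrow> 'w \<Rightarrow> real) \<Rightarrow> 'a \<times> 'a \<Rightarrow> real" where
  "product_moment M F p = (\<integral>\<omega>. F (fst p) \<omega> * F (snd p) \<omega> \<partial>M)"

text \<open>
  Two applications of the one-dimensional mean value theorem: in the first argument to the
  difference of \<open>K\<close> at the two values of the second, and then in the second argument to the partial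
  derivative obtained.
\<close>
lemma mixed_difference_mvt:
  fixes K :: "'a::euclidean_space \<times> 'a \<Rightarrow> real"
  assumes "k_times_cont_diff 2 K"
  shows "\<exists>\<xi> \<eta>. \<bar>\<xi>\<bar> \<le> \<bar>t\<bar> \<and> \<bar>\<eta>\<bar> \<le> \<bar>s\<bar> \<and>
    K (x + t *\<^sub>R e, y + s *\<^sub>R e) - K (x + t *\<^sub>R e, y) - K (x, y + s *\<^sub>R e) + K (x, y)
      = t * s * mixed_deriv e K (x + \<xi> *\<^sub>R e, y + \<eta> *\<^sub>R e)"
proof -
  define K1 where "K1 q = frechet_derivative K (at q) (e, 0)" for q
  have d: "K differentiable (at q)" "K1 differentiable (at q)" for q
    using assms unfolding K1_def numeral_2_eq_2 k_times_cont_diff.simps by blast+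
  have "((\<lambda>a. K (x + a *\<^sub>R e, c)) has_real_derivative K1 (x + a *\<^sub>R e, c)) (at a)" for a c
    using has_real_derivative_along_line[OF d(1), where p = "(x, c)" and a = a and v = "(e, 0)"] by (simp add: K1_def)
  then have "((\<lambda>a. K (x + a *\<^sub>R e, y + s *\<^sub>R e) - K (x + a *\<^sub>R e, y)) has_real_derivative
      K1 (x + a *\<^sub>R e, y + s *\<^sub>R e) - K1 (x + a *\<^sub>R e, y)) (at a)" for a
    by (intro DERIV_diff)
  from mvt_from_0[OF this, of t] obtain \<xi> where \<xi>: "\<bar>\<xi>\<bar> \<le> \<bar>t\<bar>"
    "K (x + t *\<^sub>R e, y + s *\<^sub>R e) - K (x + t *\<^sub>R e, y) - (K (x, y + s *\<^sub>R e) - K (x, y))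
      = t * (K1 (x + \<xi> *\<^sub>R e, y + s *\<^sub>R e) - K1 (x + \<xi> *\<^sub>R e, y))"
    by auto
  have "((\<lambda>b. K1 (x + \<xi> *\<^sub>R e, y + b *\<^sub>R e)) has_real_derivative
      mixed_deriv e K (x + \<xi> *\<^sub>R e, y + b *\<^sub>R e)) (at b)" for b
    using has_real_derivative_along_line[OF d(2), where p = "(x + \<xi> *\<^sub>R e, y)" and a = b and v = "(0, e)"]
    by (simp add: K1_def[abs_def] mixed_deriv_def)
  from mvt_from_0[OF this, of s] obtain \<eta> where "\<bar>\<eta>\<bar> \<le> \<bar>s\<bar>"
    "K1 (x + \<xi> *\<^sub>R e, y + s *\<^sub>R e) - K1 (x + \<xi> *\<^sub>R e, y)
      = s * mixed_deriv e K (x + \<xi> *\<^sub>R e, y + \<eta> *\<^sub>R e)"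
    by auto
  with \<xi> show ?thesis by (intro exI[of _ \<xi>] exI[of _ \<eta>]) (simp add: algebra_simps)
qed

lemma continuous_mixed_deriv:
  assumes "k_times_cont_diff 2 K"
  shows "continuous_on UNIV (mixed_deriv e K)"
  using assms unfolding numeral_2_eq_2 k_times_cont_diff.simps mixed_deriv_def[abs_def] by blast

text \<open>
  The increments \<open>t\<close> and \<open>s\<close> tend to \<open>0\<close> independently of each other, which is what the Cauchy
  property of the difference quotients needs.
\<close>
lemma mixed_difference_quotient_limit:
  fixes K :: "'a::euclidean_space \<times> 'a \<Rightarrow> real"
  assumes K: "k_times_cont_diff 2 K" and "\<epsilon> > 0"
  shows "\<exists>\<delta>>0. \<forall>t s. t \<noteq> 0 \<longrightarrow> \<bar>t\<bar> < \<delta> \<longrightarrow> s \<noteq> 0 \<longrightarrow> \<bar>s\<bar> < \<delta> \<longrightarrow>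
    \<bar>(K (x + t *\<^sub>R e, y + s *\<^sub>R e) - K (x + t *\<^sub>R e, y) - K (x, y + s *\<^sub>R e) + K (x, y)) / (t * s)
      - mixed_deriv e K (x, y)\<bar> < \<epsilon>"
proof -
  let ?L = "\<lambda>r :: real \<times> real. mixed_deriv e K (x + fst r *\<^sub>R e, y + snd r *\<^sub>R e)"
  have "continuous_on UNIV ?L"
    by (rule continuous_on_compose2[OF continuous_mixed_deriv[OF K]]) (auto intro!: continuous_intros)
  then have "continuous (at (0, 0)) ?L"
    by (simp add: continuous_on_eq_continuous_at)
  then obtain d where d: "d > 0" "\<And>r. dist r (0, 0) < d \<Longrightarrow> dist (?L r) (?L (0, 0)) < \<epsilon>"
    using \<open>\<epsilon> > 0\<close> unfolding continuous_at_eps_delta by blast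
  show ?thesis
  proof (intro exI[of _ "d / 2"] conjI allI impI)
    fix t s :: real assume ts: "t \<noteq> 0" "\<bar>t\<bar> < d / 2" "s \<noteq> 0" "\<bar>s\<bar> < d / 2"
    obtain \<xi> \<eta> where *: "\<bar>\<xi>\<bar> \<le> \<bar>t\<bar>" "\<bar>\<eta>\<bar> \<le> \<bar>s\<bar>"
      "K (x + t *\<^sub>R e, y + s *\<^sub>R e) - K (x + t *\<^sub>R e, y) - K (x, y + s *\<^sub>R e) + K (x, y)
        = t * s * mixed_deriv e K (x + \<xi> *\<^sub>R e, y + \<eta> *\<^sub>R e)"
      using mixed_difference_mvt[OF K] by metis
    have "dist (\<xi>, \<eta>) (0, 0) \<le> \<bar>\<xi>\<bar> + \<bar>\<eta>\<bar>"
      using norm_Pair_le[of \<xi> \<eta>] by (simp add: dist_norm)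
    also have "\<dots> < d" using * ts by linarith
    finally show "\<bar>(K (x + t *\<^sub>R e, y + s *\<^sub>R e) - K (x + t *\<^sub>R e, y) - K (x, y + s *\<^sub>R e) + K (x, y)) / (t * s)
      - mixed_deriv e K (x, y)\<bar> < \<epsilon>"
      using d(2) ts *(3) by (fastforce simp: dist_real_def)
  qed (use d in auto)
qed

lemma diff_quot_L2:
  assumes "\<And>y. F y \<in> L2_rv M"
  shows "diff_quot F e x t \<in> L2_rv M"
  unfolding diff_quot_def[abs_def] by (intro L2_rv_divide L2_rv_diff assms)

lemma diff_quot_inner:
  assumes F: "\<And>y. F y \<in> L2_rv M" and K: "K = product_moment M F"
  shows "(\<integral>\<omega>. diff_quot F e x t \<omega> * diff_quot F e y s \<omega> \<partial>M) =
    (K (x + t *\<^sub>R e, y + s *\<^sub>R e) - K (x + t *\<^sub>R e, y) - K (x, y + s *\<^sub>R e) + K (x, y)) / (t * s)"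
proof -
  have i: "integrable M (\<lambda>\<omega>. F a \<omega> * F b \<omega>)" for a b
    by (rule integrable_mult_L2[OF F F])
  have "(\<integral>\<omega>. diff_quot F e x t \<omega> * diff_quot F e y s \<omega> \<partial>M) =
    (\<integral>\<omega>. (F (x + t *\<^sub>R e) \<omega> * F (y + s *\<^sub>R e) \<omega> - F (x + t *\<^sub>R e) \<omega> * F y \<omega>
      - F x \<omega> * F (y + s *\<^sub>R e) \<omega> + F x \<omega> * F y \<omega>) / (t * s) \<partial>M)"
    by (rule Bochner_Integration.integral_cong) (auto simp: diff_quot_def algebra_simps)
  also have "\<dots> = (K (x + t *\<^sub>R e, y + s *\<^sub>R e) - K (x + t *\<^sub>R e, y) - K (x, y + s *\<^sub>R e) + K (x, y)) / (t * s)"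
    by (simp add: K product_moment_def i)
  finally show ?thesis .
qed

lemma diff_quot_inner_limit:
  fixes F :: "'a::euclidean_space \<Rightarrow> 'w \<Rightarrow> real"
  assumes F: "\<And>y. F y \<in> L2_rv M" and K: "k_times_cont_diff 2 (product_moment M F)" and "\<epsilon> > 0"
  shows "\<exists>\<delta>>0. \<forall>t s. t \<noteq> 0 \<longrightarrow> \<bar>t\<bar> < \<delta> \<longrightarrow> s \<noteq> 0 \<longrightarrow> \<bar>s\<bar> < \<delta> \<longrightarrow>
    \<bar>(\<integral>\<omega>. diff_quot F e x t \<omega> * diff_quot F e y s \<omega> \<partial>M)
      - mixed_deriv e (product_moment M F) (x, y)\<bar> < \<epsilon>"
  unfolding diff_quot_inner[OF F refl]
  by (rule mixed_difference_quotient_limit[OF K \<open>\<epsilon> > 0\<close>])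

lemma has_ms_deriv_diff_quot:
  "has_ms_deriv M F e x G \<longleftrightarrow>
     (\<forall>y. F y \<in> L2_rv M) \<and> L2_conv M (diff_quot F e x) G (at 0)"
  by (auto simp: has_ms_deriv_def L2_conv_def diff_quot_L2) (simp_all add: diff_quot_def)

text \<open>
  Expanding \<open>E (D t - D s)\<^sup>2\<close> gives three inner products of difference quotients, all with the same
  limit as \<open>t\<close> and \<open>s\<close> tend to \<open>0\<close> and with coefficients \<open>1, -2, 1\<close>.  So the quotients are Cauchy in
  \<open>L\<^sup>2\<close>.
\<close>
lemma (in prob_space) ms_deriv_exists:
  fixes F :: "'b::euclidean_space \<Rightarrow> 'a \<Rightarrow> real"
  assumes F: "\<And>y. F y \<in> L2_rv M" and K: "k_times_cont_diff 2 (product_moment M F)"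
  shows "\<exists>G. has_ms_deriv M F e x G"
proof -
  let ?D = "diff_quot F e x"
  note D = diff_quot_L2[of F M e x, OF F]
  have close: "\<exists>\<delta>>0. \<forall>t s. t \<noteq> 0 \<longrightarrow> \<bar>t\<bar> < \<delta> \<longrightarrow> s \<noteq> 0 \<longrightarrow> \<bar>s\<bar> < \<delta> \<longrightarrow>
      (\<integral>\<omega>. (?D t \<omega> - ?D s \<omega>)\<^sup>2 \<partial>M) < \<epsilon>" if "\<epsilon> > 0" for \<epsilon>
  proof -
    let ?I = "\<lambda>t s. \<integral>\<omega>. ?D t \<omega> * ?D s \<omega> \<partial>M"
    obtain \<delta> where \<delta>: "\<delta> > 0" "\<And>t s. t \<noteq> 0 \<Longrightarrow> \<bar>t\<bar> < \<delta> \<Longrightarrow> s \<noteq> 0 \<Longrightarrow> \<bar>s\<bar> < \<delta> \<Longrightarrow>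
      \<bar>?I t s - mixed_deriv e (product_moment M F) (x, x)\<bar> < \<epsilon> / 4"
      using diff_quot_inner_limit[of F M "\<epsilon> / 4" e x x, OF F K] \<open>\<epsilon> > 0\<close> by auto
    have "(\<integral>\<omega>. (?D t \<omega> - ?D s \<omega>)\<^sup>2 \<partial>M) = ?I t t - 2 * ?I t s + ?I s s" for t s
    proof -
      have "(\<integral>\<omega>. (?D t \<omega> - ?D s \<omega>)\<^sup>2 \<partial>M) =
        (\<integral>\<omega>. ?D t \<omega> * ?D t \<omega> - 2 * (?D t \<omega> * ?D s \<omega>) + ?D s \<omega> * ?D s \<omega> \<partial>M)"
        by (rule Bochner_Integration.integral_cong) (auto simp: power2_eq_square algebra_simps)
      then show ?thesis by (simp add: integrable_mult_L2[OF D D])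
    qed
    moreover have "?I t t - 2 * ?I t s + ?I s s < \<epsilon>"
      if "t \<noteq> 0" "\<bar>t\<bar> < \<delta>" "s \<noteq> 0" "\<bar>s\<bar> < \<delta>" for t s
      using \<delta>(2)[of t t] \<delta>(2)[of t s] \<delta>(2)[of s s] that by linarith
    ultimately show ?thesis using \<delta>(1) by auto
  qed
  define X where "X n = ?D (1 / real (Suc n))" for n
  have small: "\<exists>N. \<forall>n\<ge>N. \<bar>1 / real (Suc n)\<bar> < \<delta>" if "\<delta> > 0" for \<delta> :: real
    using LIMSEQ_D[OF LIMSEQ_inverse_real_of_nat that] by (simp add: inverse_eq_divide)
  have "\<exists>G. L2_conv M X G sequentially"
  proof (rule L2_complete)
    show "X n \<in> L2_rv M" for n using D by (simp add: X_def)
    fix \<epsilon> :: real assume "\<epsilon> > 0"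
    from close[OF this] obtain \<delta> where "\<delta> > 0"
      and \<delta>: "\<And>t s. t \<noteq> 0 \<Longrightarrow> \<bar>t\<bar> < \<delta> \<Longrightarrow> s \<noteq> 0 \<Longrightarrow> \<bar>s\<bar> < \<delta> \<Longrightarrow> (\<integral>\<omega>. (?D t \<omega> - ?D s \<omega>)\<^sup>2 \<partial>M) < \<epsilon>"
      by blast
    obtain N where N: "\<And>n. n \<ge> N \<Longrightarrow> \<bar>1 / real (Suc n)\<bar> < \<delta>" using small[OF \<open>\<delta> > 0\<close>] by blast
    show "\<exists>N. \<forall>m\<ge>N. \<forall>n\<ge>N. (\<integral>\<omega>. (X m \<omega> - X n \<omega>)\<^sup>2 \<partial>M) < \<epsilon>"
      unfolding X_def by (intro exI[of _ N] allI impI \<delta> N) auto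
  qed
  then obtain G where G: "L2_conv M X G sequentially" by blast
  then have G2: "G \<in> L2_rv M" and Glim: "(\<lambda>n. \<integral>\<omega>. (X n \<omega> - G \<omega>)\<^sup>2 \<partial>M) \<longlonglongrightarrow> 0"
    by (auto simp: L2_conv_def)
  have "((\<lambda>t. \<integral>\<omega>. (?D t \<omega> - G \<omega>)\<^sup>2 \<partial>M) \<longlongrightarrow> 0) (at 0)"
  proof (rule LIM_I)
    fix \<epsilon> :: real assume "\<epsilon> > 0"
    then have "\<epsilon> / 4 > 0" by simp
    from close[OF this] obtain \<delta> where "\<delta> > 0"
      and \<delta>: "\<And>t s. t \<noteq> 0 \<Longrightarrow> \<bar>t\<bar> < \<delta> \<Longrightarrow> s \<noteq> 0 \<Longrightarrow> \<bar>s\<bar> < \<delta> \<Longrightarrow> (\<integral>\<omega>. (?D t \<omega> - ?D s \<omega>)\<^sup>2 \<partial>M) < \<epsilon> / 4"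
      by blast
    obtain N where N: "\<And>n. n \<ge> N \<Longrightarrow> \<bar>1 / real (Suc n)\<bar> < \<delta>" using small[OF \<open>\<delta> > 0\<close>] by blast
    obtain N' where N': "\<And>n. n \<ge> N' \<Longrightarrow> (\<integral>\<omega>. (X n \<omega> - G \<omega>)\<^sup>2 \<partial>M) < \<epsilon> / 4"
      using LIMSEQ_D[OF Glim \<open>\<epsilon> / 4 > 0\<close>] by auto
    define n where "n = max N N'"
    have "(\<integral>\<omega>. (?D t \<omega> - G \<omega>)\<^sup>2 \<partial>M) < \<epsilon>" if "t \<noteq> 0" "\<bar>t\<bar> < \<delta>" for t
    proof -
      have "(\<integral>\<omega>. (?D t \<omega> - X n \<omega>)\<^sup>2 \<partial>M) < \<epsilon> / 4"
        unfolding X_def using that N[of n] by (intro \<delta>) (auto simp: n_def)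
      moreover have "(\<integral>\<omega>. (X n \<omega> - G \<omega>)\<^sup>2 \<partial>M) < \<epsilon> / 4" by (rule N') (simp add: n_def)
      moreover have "(\<integral>\<omega>. (?D t \<omega> - G \<omega>)\<^sup>2 \<partial>M) \<le>
          2 * (\<integral>\<omega>. (?D t \<omega> - X n \<omega>)\<^sup>2 \<partial>M) + 2 * (\<integral>\<omega>. (X n \<omega> - G \<omega>)\<^sup>2 \<partial>M)"
        by (rule L2_dist_triangle) (auto simp: X_def D G2)
      ultimately show ?thesis by linarith
    qed
    then show "\<exists>\<delta>>0. \<forall>t. t \<noteq> 0 \<and> norm (t - 0) < \<delta> \<longrightarrow> norm ((\<integral>\<omega>. (?D t \<omega> - G \<omega>)\<^sup>2 \<partial>M) - 0) < \<epsilon>"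
      using \<open>\<delta> > 0\<close> by (intro exI[of _ \<delta>]) auto
  qed
  then show ?thesis
    using F D G2 by (auto simp: has_ms_deriv_diff_quot L2_conv_def)
qed

text \<open>
  This makes differentiation iterable: the kernel of the derivative field has two orders of
  smoothness fewer than that of the field, whichever versions of the derivatives are chosen.
\<close>
lemma product_moment_ms_deriv:
  fixes F :: "'a::euclidean_space \<Rightarrow> 'w \<Rightarrow> real"
  assumes K: "k_times_cont_diff 2 (product_moment M F)"
    and G: "\<And>x. has_ms_deriv M F e x (G x)"
  shows "product_moment M G = mixed_deriv e (product_moment M F)"
proof
  fix p :: "'a \<times> 'a"
  obtain x y where p: "p = (x, y)" by (cases p)
  have F: "F y \<in> L2_rv M" for y using G has_ms_deriv_diff_quot by blast
  let ?I = "\<lambda>t. \<integral>\<omega>. diff_quot F e x t \<omega> * diff_quot F e y t \<omega> \<partial>M"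
  have "(?I \<longlongrightarrow> product_moment M G p) (at 0)"
    unfolding product_moment_def p fst_conv snd_conv
    by (rule L2_conv_inner) (use G has_ms_deriv_diff_quot in blast)+
  moreover have "(?I \<longlongrightarrow> mixed_deriv e (product_moment M F) p) (at 0)"
  proof (rule LIM_I)
    fix \<epsilon> :: real assume "\<epsilon> > 0"
    from diff_quot_inner_limit[of F M, OF F K this, of e x y]
    obtain \<delta> where "\<delta> > 0" "\<And>t. t \<noteq> 0 \<Longrightarrow> \<bar>t\<bar> < \<delta> \<Longrightarrow>
        \<bar>?I t - mixed_deriv e (product_moment M F) p\<bar> < \<epsilon>"
      unfolding p by blast
    then show "\<exists>\<delta>>0. \<forall>t. t \<noteq> 0 \<and> norm (t - 0) < \<delta> \<longrightarrow>
        norm (?I t - mixed_deriv e (product_moment M F) p) < \<epsilon>"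
      by (intro exI[of _ \<delta>]) auto
  qed
  ultimately show "product_moment M G p = mixed_deriv e (product_moment M F) p"
    by (rule tendsto_unique[OF at_neq_bot])
qed

lemma has_ms_deriv_ms_deriv: "has_ms_deriv M F e x G \<Longrightarrow> has_ms_deriv M F e x (ms_deriv M F e x)"
  unfolding ms_deriv_def by (rule someI[of "has_ms_deriv M F e x"])


section \<open>Calculus of \<open>k\<close> times continuously differentiable functions\<close>

lemma k_times_cont_diff_Suc_imp: "k_times_cont_diff (Suc k) F \<Longrightarrow> k_times_cont_diff k F"
proof (induction k arbitrary: F)
  case 0
  then show ?case
    by (auto intro!: continuous_at_imp_continuous_on differentiable_imp_continuous_within)
next
  case (Suc k)
  have "k_times_cont_diff k (\<lambda>x. frechet_derivative F (at x) v)" for v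
    using Suc.prems by (intro Suc.IH) simp
  then show ?case using Suc.prems by simp
qed

lemma k_times_cont_diff_add:
  "k_times_cont_diff k F \<Longrightarrow> k_times_cont_diff k G \<Longrightarrow> k_times_cont_diff k (\<lambda>x. F x + G x)"
proof (induction k arbitrary: F G)
  case 0
  then show ?case by (auto intro!: continuous_intros)
next
  case (Suc k)
  then have d: "F differentiable (at x)" "G differentiable (at x)" for x by auto
  have "(\<lambda>x. frechet_derivative (\<lambda>x. F x + G x) (at x) v) =
      (\<lambda>x. frechet_derivative F (at x) v + frechet_derivative G (at x) v)" for v
    by (rule ext, subst frechet_derivative_at[symmetric],
        rule has_derivative_add[OF d[unfolded frechet_derivative_works]]) simp
  then show ?case using Suc d by auto
qed

lemma k_times_cont_diff_minus:
  "k_times_cont_diff k F \<Longrightarrow> k_times_cont_diff k (\<lambda>x. - F x)"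
proof (induction k arbitrary: F)
  case 0
  then show ?case by (auto intro!: continuous_intros)
next
  case (Suc k)
  then have d: "F differentiable (at x)" for x by auto
  have "(\<lambda>x. frechet_derivative (\<lambda>x. - F x) (at x) v) = (\<lambda>x. - frechet_derivative F (at x) v)" for v
    by (rule ext, subst frechet_derivative_at[symmetric],
        rule has_derivative_minus[OF d[unfolded frechet_derivative_works]]) simp
  then show ?case using Suc d by auto
qed

lemma k_times_cont_diff_compose_linear:
  assumes L: "bounded_linear L"
  shows "k_times_cont_diff k F \<Longrightarrow> k_times_cont_diff k (\<lambda>x. F (L x))"
proof (induction k arbitrary: F)
  case 0
  then show ?case
    using continuous_on_compose2[of UNIV F UNIV L] bounded_linear.continuous_on[OF L continuous_on_id] by auto
next
  case (Suc k)
  have d: "((\<lambda>x. F (L x)) has_derivative (\<lambda>v. frechet_derivative F (at (L x)) (L v))) (at x)" for x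
    using has_derivative_compose[OF bounded_linear_imp_has_derivative[OF L], of F _ x UNIV] Suc.prems
    by (simp add: frechet_derivative_works)
  have "(\<lambda>x. frechet_derivative (\<lambda>x. F (L x)) (at x) v) = (\<lambda>x. frechet_derivative F (at (L x)) (L v))" for v
    by (rule ext, subst frechet_derivative_at[OF d, symmetric]) simp
  moreover have "k_times_cont_diff k (\<lambda>x. frechet_derivative F (at (L x)) (L v))" for v
    using Suc.prems by (intro Suc.IH) simp
  ultimately show ?case using d by (auto simp: differentiable_def)
qed

section \<open>Centered Gaussian variables\<close>

text \<open>
  The law is prescribed through its characteristic function, which passes to \<open>L\<^sup>2\<close> limits more
  easily than a density; in this form the degenerate case of zero variance needs no separate
  clause.
\<close>
definition centered_gaussian :: "'w measure \<Rightarrow> ('w \<Rightarrow> real) \<Rightarrow> bool" where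
  "centered_gaussian M X \<longleftrightarrow> X \<in> L2_rv M \<and> integral\<^sup>L M X = 0 \<and>
     (\<forall>t. char (distr M borel X) t = complex_of_real (exp (- (t\<^sup>2 * (\<integral>\<omega>. (X \<omega>)\<^sup>2 \<partial>M)) / 2)))"

lemma norm_iexp_diff_le: "norm (iexp a - iexp b) \<le> \<bar>a - b\<bar>"
proof -
  have "iexp a - iexp b = iexp b * (iexp (a - b) - 1)"
    by (simp add: algebra_simps flip: exp_add)
  then have "norm (iexp a - iexp b) = norm (iexp (a - b) - 1)"
    by (simp add: norm_mult)
  also have "\<dots> \<le> \<bar>a - b\<bar>"
    using iexp_approx1[of "a - b" 0] by simp
  finally show ?thesis .
qed

lemma (in prob_space) char_distr_L2_diff:
  assumes X: "X \<in> L2_rv M" and Y: "Y \<in> L2_rv M"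
  shows "norm (char (distr M borel X) t - char (distr M borel Y) t)
    \<le> \<bar>t\<bar> * sqrt (\<integral>\<omega>. (X \<omega> - Y \<omega>)\<^sup>2 \<partial>M)"
proof -
  have [measurable]: "X \<in> borel_measurable M" "Y \<in> borel_measurable M"
    using X Y by (auto intro: L2_rvD)
  have D: "(\<lambda>\<omega>. X \<omega> - Y \<omega>) \<in> L2_rv M" by (rule L2_rv_diff[OF X Y])
  have i: "integrable M (\<lambda>\<omega>. iexp (t * X \<omega>))" "integrable M (\<lambda>\<omega>. iexp (t * Y \<omega>))"
    by (auto intro!: integrable_iexp)
  have "char (distr M borel X) t - char (distr M borel Y) t
      = (CLINT \<omega>|M. iexp (t * X \<omega>) - iexp (t * Y \<omega>))"
    using i by (simp add: char_def integral_distr)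
  also have "norm \<dots> \<le> (\<integral>\<omega>. norm (iexp (t * X \<omega>) - iexp (t * Y \<omega>)) \<partial>M)"
    by (rule integral_norm_bound)
  also have "\<dots> \<le> (\<integral>\<omega>. \<bar>t\<bar> * \<bar>X \<omega> - Y \<omega>\<bar> \<partial>M)"
  proof (rule integral_mono)
    show "norm (iexp (t * X \<omega>) - iexp (t * Y \<omega>)) \<le> \<bar>t\<bar> * \<bar>X \<omega> - Y \<omega>\<bar>" for \<omega>
      using norm_iexp_diff_le[of "t * X \<omega>" "t * Y \<omega>"] by (simp flip: right_diff_distrib abs_mult)
  qed (use i integrable_L2[OF D] in auto)
  also have "\<dots> = \<bar>t\<bar> * (\<integral>\<omega>. \<bar>X \<omega> - Y \<omega>\<bar> \<partial>M)" by simp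
  also have "\<dots> \<le> \<bar>t\<bar> * sqrt (\<integral>\<omega>. (X \<omega> - Y \<omega>)\<^sup>2 \<partial>M)"
    by (intro mult_left_mono L1_le_L2[OF D]) simp
  finally show ?thesis .
qed

text \<open>
  The mean, the second moment and, by \<open>char_distr_L2_diff\<close>, the characteristic function are all
  continuous with respect to \<open>L\<^sup>2\<close> convergence, so the defining identity carries over to the limit.
\<close>
lemma (in prob_space) centered_gaussian_L2_limit:
  assumes X: "\<And>n. centered_gaussian M (X n)" and conv: "L2_conv M X Y F" and F: "F \<noteq> bot"
  shows "centered_gaussian M Y"
proof -
  have Y2: "Y \<in> L2_rv M" and X2: "\<And>n. X n \<in> L2_rv M"
    and lim: "((\<lambda>n. \<integral>\<omega>. (X n \<omega> - Y \<omega>)\<^sup>2 \<partial>M) \<longlongrightarrow> 0) F"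
    using conv by (auto simp: L2_conv_def)
  have sq: "((\<lambda>n. sqrt (\<integral>\<omega>. (X n \<omega> - Y \<omega>)\<^sup>2 \<partial>M)) \<longlongrightarrow> 0) F"
    using tendsto_real_sqrt[OF lim] by simp
  have one: "L2_conv M (\<lambda>_ _. 1) (\<lambda>_. 1) F" by (simp add: L2_conv_def L2_rv_def)
  have "((\<lambda>n. integral\<^sup>L M (X n)) \<longlongrightarrow> integral\<^sup>L M Y) F"
    using L2_conv_inner[OF conv one] by simp
  moreover have "integral\<^sup>L M (X n) = 0" for n using X by (simp add: centered_gaussian_def)
  ultimately have "integral\<^sup>L M Y = 0" using F by (simp add: tendsto_const_iff)
  moreover have "char (distr M borel Y) t = complex_of_real (exp (- (t\<^sup>2 * (\<integral>\<omega>. (Y \<omega>)\<^sup>2 \<partial>M)) / 2))" for t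
  proof (rule tendsto_unique[OF F])
    have "((\<lambda>n. char (distr M borel (X n)) t - char (distr M borel Y) t) \<longlongrightarrow> 0) F"
    proof (rule Lim_null_comparison)
      show "\<forall>\<^sub>F n in F. norm (char (distr M borel (X n)) t - char (distr M borel Y) t)
          \<le> \<bar>t\<bar> * sqrt (\<integral>\<omega>. (X n \<omega> - Y \<omega>)\<^sup>2 \<partial>M)"
        using char_distr_L2_diff[OF X2 Y2] by (intro always_eventually allI)
      show "((\<lambda>n. \<bar>t\<bar> * sqrt (\<integral>\<omega>. (X n \<omega> - Y \<omega>)\<^sup>2 \<partial>M)) \<longlongrightarrow> 0) F"
        using tendsto_mult_left[OF sq, of "\<bar>t\<bar>"] by simp
    qed
    then show "((\<lambda>n. char (distr M borel (X n)) t) \<longlongrightarrow> char (distr M borel Y) t) F"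
      by (rule LIM_zero_cancel)
    have "((\<lambda>n. \<integral>\<omega>. (X n \<omega>)\<^sup>2 \<partial>M) \<longlongrightarrow> (\<integral>\<omega>. (Y \<omega>)\<^sup>2 \<partial>M)) F"
      using L2_conv_inner[OF conv conv] by (simp add: power2_eq_square)
    then have "((\<lambda>n. complex_of_real (exp (- (t\<^sup>2 * (\<integral>\<omega>. (X n \<omega>)\<^sup>2 \<partial>M)) / 2)))
        \<longlongrightarrow> complex_of_real (exp (- (t\<^sup>2 * (\<integral>\<omega>. (Y \<omega>)\<^sup>2 \<partial>M)) / 2))) F"
      by (intro tendsto_intros) auto
    then show "((\<lambda>n. char (distr M borel (X n)) t)
        \<longlongrightarrow> complex_of_real (exp (- (t\<^sup>2 * (\<integral>\<omega>. (Y \<omega>)\<^sup>2 \<partial>M)) / 2))) F"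
      using X by (simp add: centered_gaussian_def)
  qed
  ultimately show ?thesis using Y2 by (simp add: centered_gaussian_def)
qed

lemma (in prob_space) gaussian_rv_L2:
  assumes "gaussian_rv M X"
  shows "X \<in> L2_rv M"
proof -
  have [measurable]: "X \<in> borel_measurable M" using assms by (simp add: gaussian_rv_def)
  from assms consider c where "AE \<omega> in M. X \<omega> = c"
    | \<mu> \<sigma> where "\<sigma> > 0" "distributed M lborel X (normal_density \<mu> \<sigma>)"
    unfolding gaussian_rv_def by blast
  then show ?thesis
  proof cases
    case 1
    then have "AE \<omega> in M. (X \<omega>)\<^sup>2 = c\<^sup>2" by eventually_elim simp
    then have "integrable M (\<lambda>\<omega>. (X \<omega>)\<^sup>2)"
      by (subst integrable_cong_AE[where g = "\<lambda>_. c\<^sup>2"]) auto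
    then show ?thesis by (simp add: L2_rv_def)
  next
    case 2
    have "integrable M (\<lambda>\<omega>. (X \<omega> - \<mu>)\<^sup>2)"
      using distributed_integrable[OF 2(2), of "\<lambda>x. (x - \<mu>)\<^sup>2"] integrable_normal_moment[OF 2(1), of \<mu> 2]
      by simp
    then have "(\<lambda>\<omega>. X \<omega> - \<mu>) \<in> L2_rv M" by (simp add: L2_rv_def)
    moreover have "(\<lambda>\<omega>. \<mu>) \<in> L2_rv M" by (simp add: L2_rv_def)
    ultimately have "(\<lambda>\<omega>. (X \<omega> - \<mu>) + \<mu>) \<in> L2_rv M" by (rule L2_rv_add)
    then show ?thesis by simp
  qed
qed

lemma (in prob_space) gaussian_field_L2:
  assumes "gaussian_field M u"
  shows "u x \<in> L2_rv M"
  using assms[unfolded gaussian_field_def, rule_format, of "{x}" "\<lambda>_. 1"]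
  by (intro gaussian_rv_L2) simp

lemma char_distr_scaled_normal:
  "char (distr std_normal_distribution borel (\<lambda>x. \<sigma> * x)) t
     = complex_of_real (exp (- (t\<^sup>2 * \<sigma>\<^sup>2) / 2))"
proof -
  have "char (distr std_normal_distribution borel (\<lambda>x. \<sigma> * x)) t = char std_normal_distribution (t * \<sigma>)"
    by (simp add: char_def integral_distr mult.assoc)
  then show ?thesis
    by (simp add: char_std_normal_distribution power_mult_distrib)
qed

lemma (in prob_space) gaussian_rv_imp_centered_gaussian:
  assumes X: "gaussian_rv M X" and mean: "integral\<^sup>L M X = 0"
  shows "centered_gaussian M X"
proof -
  have X2: "X \<in> L2_rv M" by (rule gaussian_rv_L2[OF X])
  then have [measurable]: "X \<in> borel_measurable M" by (rule L2_rvD)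
  from X consider c where "AE \<omega> in M. X \<omega> = c"
    | \<mu> \<sigma> where "\<sigma> > 0" "distributed M lborel X (normal_density \<mu> \<sigma>)"
    unfolding gaussian_rv_def by blast
  then show ?thesis
  proof cases
    case 1
    have "integral\<^sup>L M X = (\<integral>\<omega>. c \<partial>M)" using 1 by (intro integral_cong_AE) auto
    then have "c = 0" using mean by (simp add: prob_space)
    with 1 have 0: "AE \<omega> in M. X \<omega> = 0" by simp
    have "(\<integral>\<omega>. (X \<omega>)\<^sup>2 \<partial>M) = (\<integral>\<omega>. 0 \<partial>M)" using 0 by (intro integral_cong_AE) auto
    moreover have "char (distr M borel X) t = 1" for t
    proof -
      have "char (distr M borel X) t = (CLINT \<omega>|M. iexp (t * X \<omega>))"
        by (simp add: char_def integral_distr)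
      also have "\<dots> = (CLINT \<omega>|M. 1)" using 0 by (intro integral_cong_AE) auto
      finally show ?thesis by (simp add: prob_space)
    qed
    ultimately show ?thesis using X2 mean by (simp add: centered_gaussian_def)
  next
    case 2
    have "\<mu> = 0" using normal_distributed_expectation[OF 2] mean by simp
    have var: "(\<integral>\<omega>. (X \<omega>)\<^sup>2 \<partial>M) = \<sigma>\<^sup>2"
      using normal_distributed_variance[OF 2] mean by simp
    have "distributed M lborel (\<lambda>\<omega>. X \<omega> / \<sigma>) std_normal_density"
      using 2 normal_standard_normal_convert[OF 2(1), of X \<mu>] \<open>\<mu> = 0\<close> by simp
    then have std: "distr M lborel (\<lambda>\<omega>. X \<omega> / \<sigma>) = std_normal_distribution"
      by (simp add: distributed_distr_eq_density)
    have "distr std_normal_distribution borel (\<lambda>x. \<sigma> * x) = distr M borel X"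
      unfolding std[symmetric] using 2(1) by (subst distr_distr) (auto simp: comp_def)
    then have "char (distr M borel X) t = complex_of_real (exp (- (t\<^sup>2 * \<sigma>\<^sup>2) / 2))" for t
      using char_distr_scaled_normal by metis
    then show ?thesis using X2 mean var by (simp add: centered_gaussian_def)
  qed
qed


section \<open>Quantiles of centered Gaussian variables\<close>

lemma strict_mono_cdf_std_normal:
  assumes "a < b"
  shows "cdf std_normal_distribution a < cdf std_normal_distribution b"
proof -
  interpret N: real_distribution std_normal_distribution by (rule real_dist_normal_dist)
  have "{a<..b} \<notin> null_sets std_normal_distribution"
  proof
    assume "{a<..b} \<in> null_sets std_normal_distribution"
    then have "AE x in lborel. x \<in> {a<..b} \<longrightarrow> ennreal (std_normal_density x) = 0"
      by (subst (asm) null_sets_density_iff) auto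
    moreover have "ennreal (std_normal_density x) \<noteq> 0" for x
      using normal_density_pos[of 1 0 x] by (simp add: less_le)
    ultimately have "AE x in lborel. x \<notin> {a<..b}" by simp
    then have "{a<..b} \<in> null_sets lborel"
      by (subst (asm) AE_iff_null_sets[symmetric]) auto
    then show False using \<open>a < b\<close> by (simp add: null_sets_def)
  qed
  then have "measure std_normal_distribution {a<..b} \<noteq> 0"
    by (simp add: null_sets_def N.emeasure_eq_measure)
  then have "measure std_normal_distribution {a<..b} > 0"
    using measure_nonneg[of std_normal_distribution "{a<..b}"] by linarith
  then show ?thesis using N.cdf_diff_eq[OF \<open>a < b\<close>] by simp
qed

text \<open>
  The error bound is defined by the strict inequality \<open>p < cdf\<close> and the quantile function by
  \<open>p \<le> cdf\<close>.  The infima agree because the normal distribution function is strictly increasing: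
  moving right by any \<open>\<epsilon>\<close> turns the second inequality into the first.
\<close>
lemma scaled_normal_quantile:
  assumes \<sigma>: "\<sigma> > 0" and p: "0 < p" "p < 1"
  shows "Inf {b. p < cdf std_normal_distribution (b / \<sigma>)}
    = \<sigma> * quantile_function std_normal_distribution p"
proof -
  interpret N: real_distribution std_normal_distribution by (rule real_dist_normal_dist)
  let ?F = "cdf std_normal_distribution" and ?Q = "quantile_function std_normal_distribution p"
  have "\<forall>\<^sub>F x in at_top. ?F x > p"
    using N.cdf_lim_at_top_prob p by (auto dest: order_tendstoD)
  then obtain q1 where q1: "?F q1 > p" by (auto simp: eventually_at_top_linorder)
  have "\<forall>\<^sub>F x in at_bot. ?F x < p"
    using N.cdf_lim_at_bot p by (auto dest: order_tendstoD)
  then obtain q0 where q0: "?F q0 < p" by (auto simp: eventually_at_bot_linorder)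
  have bdd: "bdd_below {q. p \<le> ?F q}"
  proof (rule bdd_belowI[of _ q0])
    fix q assume "q \<in> {q. p \<le> ?F q}"
    then show "q0 \<le> q"
      using N.cdf_nondecreasing[of q q0] q0 by (cases "q0 \<le> q") auto
  qed
  show ?thesis
  proof (rule cInf_eq_non_empty)
    show "{b. p < ?F (b / \<sigma>)} \<noteq> {}" using q1 \<sigma> by (auto intro!: exI[of _ "\<sigma> * q1"])
    fix b assume "b \<in> {b. p < ?F (b / \<sigma>)}"
    then have "?Q \<le> b / \<sigma>"
      unfolding quantile_function_def by (intro cInf_lower bdd) auto
    then show "\<sigma> * ?Q \<le> b" using \<sigma> by (simp add: field_simps)
  next
    fix y assume y: "\<And>b. b \<in> {b. p < ?F (b / \<sigma>)} \<Longrightarrow> y \<le> b"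
    have "y / \<sigma> \<le> ?Q"
      unfolding quantile_function_def
    proof (rule cInf_greatest)
      show "{q. p \<le> ?F q} \<noteq> {}" using q1 by (auto intro!: exI[of _ q1])
      fix q assume q: "q \<in> {q. p \<le> ?F q}"
      show "y / \<sigma> \<le> q"
      proof (rule field_le_epsilon)
        fix \<epsilon> :: real assume "\<epsilon> > 0"
        then have "p < ?F (q + \<epsilon>)"
          using q strict_mono_cdf_std_normal[of q "q + \<epsilon>"] by auto
        then have "y \<le> \<sigma> * (q + \<epsilon>)" using \<sigma> by (intro y) simp
        then show "y / \<sigma> \<le> q + \<epsilon>" using \<sigma> by (simp add: field_simps)
      qed
    qed
    then show "y \<le> \<sigma> * ?Q" using \<sigma> by (simp add: field_simps)
  qed
qed

text \<open>
  For positive variance the law is a rescaled standard normal one by uniqueness of characteristic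
  functions.  For zero variance the variable vanishes almost surely, the set of admissible bounds is
  \<open>{0..}\<close>, and both sides are \<open>0\<close>.
\<close>
lemma (in prob_space) error_bound_centered_gaussian:
  assumes X: "centered_gaussian M X" and p: "0 < p" "p < 1"
  shows "error_bound M p X = std_dev M X * quantile_function std_normal_distribution p"
proof -
  have X2: "X \<in> L2_rv M" and mean: "integral\<^sup>L M X = 0"
    using X by (auto simp: centered_gaussian_def)
  have [measurable]: "X \<in> borel_measurable M" by (rule L2_rvD[OF X2])
  define \<sigma> where "\<sigma> = std_dev M X"
  have \<sigma>: "\<sigma> = sqrt (\<integral>\<omega>. (X \<omega>)\<^sup>2 \<partial>M)" by (simp add: \<sigma>_def std_dev_def mean)
  then have "\<sigma> \<ge> 0" and \<sigma>2: "(\<integral>\<omega>. (X \<omega>)\<^sup>2 \<partial>M) = \<sigma>\<^sup>2" by auto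
  show ?thesis
  proof (cases "\<sigma> = 0")
    case True
    then have "AE \<omega> in M. (X \<omega>)\<^sup>2 = 0"
      using \<sigma>2 integral_nonneg_eq_0_iff_AE[OF L2_rvD(2)[OF X2]] by simp
    then have 0: "AE \<omega> in M. X \<omega> = 0" by simp
    have "measure M {\<omega> \<in> space M. X \<omega> \<le> b} = (if 0 \<le> b then 1 else 0)" for b
    proof -
      have "measure M {\<omega> \<in> space M. X \<omega> \<le> b} = measure M {\<omega> \<in> space M. 0 \<le> b}"
        using 0 by (intro measure_eq_AE) auto
      then show ?thesis by (simp add: prob_space)
    qed
    then have "{b. measure M {\<omega> \<in> space M. X \<omega> \<le> b} > p} = {0..}"
      using p by auto
    then show ?thesis using True by (simp add: error_bound_def \<sigma>_def[symmetric])
  next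
    case False
    then have pos: "\<sigma> > 0" using \<open>\<sigma> \<ge> 0\<close> by simp
    interpret N: real_distribution std_normal_distribution by (rule real_dist_normal_dist)
    have law: "distr M borel X = distr std_normal_distribution borel (\<lambda>x. \<sigma> * x)"
    proof (rule Levy_uniqueness)
      show "char (distr M borel X) = char (distr std_normal_distribution borel (\<lambda>x. \<sigma> * x))"
        using X by (auto simp: fun_eq_iff centered_gaussian_def char_distr_scaled_normal \<sigma>2)
    qed (auto intro: N.real_distribution_distr)
    have "measure M {\<omega> \<in> space M. X \<omega> \<le> b} = cdf std_normal_distribution (b / \<sigma>)" for b
    proof -
      have "measure M {\<omega> \<in> space M. X \<omega> \<le> b} = measure (distr M borel X) {..b}"
        by (subst measure_distr) (auto intro!: arg_cong[where f = "measure M"])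
      also have "\<dots> = measure std_normal_distribution {x. \<sigma> * x \<le> b}"
        unfolding law by (subst measure_distr) (auto intro!: arg_cong[where f = "measure std_normal_distribution"])
      also have "{x. \<sigma> * x \<le> b} = {..b / \<sigma>}" using pos by (auto simp: field_simps)
      finally show ?thesis by (simp add: cdf_def2)
    qed
    then show ?thesis
      using scaled_normal_quantile[OF pos p] by (simp add: error_bound_def \<sigma>_def)
  qed
qed

section \<open>The closed linear span of a Gaussian field\<close>

definition field_span :: "('a \<Rightarrow> 'w \<Rightarrow> real) \<Rightarrow> ('w \<Rightarrow> real) set" where
  "field_span u = {X. \<exists>S c. finite S \<and> X = (\<lambda>\<omega>. \<Sum>x\<in>S. c x * u x \<omega>)}"

definition L2_closure :: "'w measure \<Rightarrow> ('w \<Rightarrow> real) set \<Rightarrow> ('w \<Rightarrow> real) set" where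
  "L2_closure M V = {X \<in> L2_rv M. \<forall>\<epsilon>>0. \<exists>Y\<in>V \<inter> L2_rv M. (\<integral>\<omega>. (X \<omega> - Y \<omega>)\<^sup>2 \<partial>M) < \<epsilon>}"

lemma field_in_span: "u x \<in> field_span u"
  unfolding field_span_def by (intro CollectI exI[of _ "{x}"] exI[of _ "\<lambda>_. 1"]) auto

lemma field_span_cmult:
  assumes "X \<in> field_span u" shows "(\<lambda>\<omega>. a * X \<omega>) \<in> field_span u"
proof -
  from assms obtain S c where "finite S" "X = (\<lambda>\<omega>. \<Sum>x\<in>S. c x * u x \<omega>)"
    by (auto simp: field_span_def)
  then show ?thesis unfolding field_span_def
    by (intro CollectI exI[of _ S] exI[of _ "\<lambda>x. a * c x"]) (auto simp: sum_distrib_left mult.assoc)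
qed

lemma field_span_add:
  assumes "X \<in> field_span u" "Y \<in> field_span u" shows "(\<lambda>\<omega>. X \<omega> + Y \<omega>) \<in> field_span u"
proof -
  from assms obtain S c T d where S: "finite S" "X = (\<lambda>\<omega>. \<Sum>x\<in>S. c x * u x \<omega>)"
    and T: "finite T" "Y = (\<lambda>\<omega>. \<Sum>x\<in>T. d x * u x \<omega>)"
    by (auto simp: field_span_def)
  let ?c = "\<lambda>x. (if x \<in> S then c x else 0) + (if x \<in> T then d x else 0)"
  have "X \<omega> + Y \<omega> = (\<Sum>x\<in>S \<union> T. ?c x * u x \<omega>)" for \<omega>
  proof -
    have "X \<omega> = (\<Sum>x\<in>S \<union> T. (if x \<in> S then c x else 0) * u x \<omega>)"
      unfolding S(2) using S T by (intro sum.mono_neutral_cong_left) auto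
    moreover have "Y \<omega> = (\<Sum>x\<in>S \<union> T. (if x \<in> T then d x else 0) * u x \<omega>)"
      unfolding T(2) using S T by (intro sum.mono_neutral_cong_left) auto
    ultimately show ?thesis by (simp add: sum.distrib distrib_right)
  qed
  then show ?thesis using S(1) T(1) unfolding field_span_def
    by (intro CollectI exI[of _ "S \<union> T"] exI[of _ ?c]) auto
qed

lemma L2_closureE:
  assumes "X \<in> L2_closure M V" "\<epsilon> > 0"
  obtains Y where "Y \<in> V" "Y \<in> L2_rv M" "(\<integral>\<omega>. (X \<omega> - Y \<omega>)\<^sup>2 \<partial>M) < \<epsilon>"
  using assms unfolding L2_closure_def by blast

lemma L2_closure_superset: "X \<in> V \<Longrightarrow> X \<in> L2_rv M \<Longrightarrow> X \<in> L2_closure M V"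
  unfolding L2_closure_def by (auto intro!: bexI[of _ X])

lemma L2_closure_add:
  assumes V: "\<And>X Y. X \<in> V \<Longrightarrow> Y \<in> V \<Longrightarrow> (\<lambda>\<omega>. X \<omega> + Y \<omega>) \<in> V"
    and X: "X \<in> L2_closure M V" and Y: "Y \<in> L2_closure M V"
  shows "(\<lambda>\<omega>. X \<omega> + Y \<omega>) \<in> L2_closure M V"
proof -
  have XY: "X \<in> L2_rv M" "Y \<in> L2_rv M" using X Y by (auto simp: L2_closure_def)
  have "\<exists>Z\<in>V \<inter> L2_rv M. (\<integral>\<omega>. (X \<omega> + Y \<omega> - Z \<omega>)\<^sup>2 \<partial>M) < \<epsilon>" if \<epsilon>: "\<epsilon> > 0" for \<epsilon>
  proof -
    obtain X' where X': "X' \<in> V" "X' \<in> L2_rv M" "(\<integral>\<omega>. (X \<omega> - X' \<omega>)\<^sup>2 \<partial>M) < \<epsilon> / 4"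
      by (rule L2_closureE[OF X, of "\<epsilon> / 4"]) (use \<epsilon> in auto)
    obtain Y' where Y': "Y' \<in> V" "Y' \<in> L2_rv M" "(\<integral>\<omega>. (Y \<omega> - Y' \<omega>)\<^sup>2 \<partial>M) < \<epsilon> / 4"
      by (rule L2_closureE[OF Y, of "\<epsilon> / 4"]) (use \<epsilon> in auto)
    have "(\<integral>\<omega>. (X \<omega> + Y \<omega> - (X' \<omega> + Y' \<omega>))\<^sup>2 \<partial>M)
      \<le> 2 * (\<integral>\<omega>. (X \<omega> + Y \<omega> - (X' \<omega> + Y \<omega>))\<^sup>2 \<partial>M) + 2 * (\<integral>\<omega>. (X' \<omega> + Y \<omega> - (X' \<omega> + Y' \<omega>))\<^sup>2 \<partial>M)"
      by (intro L2_dist_triangle L2_rv_add XY X' Y')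
    also have "\<dots> < \<epsilon>" using X' Y' by simp
    finally show ?thesis
      by (intro bexI[of _ "\<lambda>\<omega>. X' \<omega> + Y' \<omega>"] IntI V L2_rv_add X' Y')
  qed
  then show ?thesis using L2_rv_add[OF XY] by (simp add: L2_closure_def)
qed

lemma L2_closure_cmult:
  assumes V: "\<And>X. X \<in> V \<Longrightarrow> (\<lambda>\<omega>. a * X \<omega>) \<in> V" and X: "X \<in> L2_closure M V"
  shows "(\<lambda>\<omega>. a * X \<omega>) \<in> L2_closure M V"
proof -
  have X2: "X \<in> L2_rv M" using X by (auto simp: L2_closure_def)
  have "\<exists>Z\<in>V \<inter> L2_rv M. (\<integral>\<omega>. (a * X \<omega> - Z \<omega>)\<^sup>2 \<partial>M) < \<epsilon>" if \<epsilon>: "\<epsilon> > 0" for \<epsilon>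
  proof -
    have a: "a\<^sup>2 + 1 > 0" using zero_le_power2[of a] by linarith
    then have \<epsilon>': "\<epsilon> / (a\<^sup>2 + 1) > 0" using that by simp
    obtain X' where X': "X' \<in> V" "X' \<in> L2_rv M" "(\<integral>\<omega>. (X \<omega> - X' \<omega>)\<^sup>2 \<partial>M) < \<epsilon> / (a\<^sup>2 + 1)"
      by (rule L2_closureE[OF X \<epsilon>'])
    have "(\<integral>\<omega>. (a * X \<omega> - a * X' \<omega>)\<^sup>2 \<partial>M) = a\<^sup>2 * (\<integral>\<omega>. (X \<omega> - X' \<omega>)\<^sup>2 \<partial>M)"
      by (simp flip: right_diff_distrib integral_mult_right_zero add: power_mult_distrib)
    also have "\<dots> \<le> (a\<^sup>2 + 1) * (\<integral>\<omega>. (X \<omega> - X' \<omega>)\<^sup>2 \<partial>M)"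
      by (intro mult_right_mono) auto
    also have "\<dots> < \<epsilon>" using X'(3) a by (simp add: field_simps)
    finally show ?thesis
      by (intro bexI[of _ "\<lambda>\<omega>. a * X' \<omega>"] IntI V L2_rv_cmult X')
  qed
  then show ?thesis using L2_rv_cmult[OF X2] by (simp add: L2_closure_def)
qed

lemma L2_closure_limit:
  assumes X: "\<And>i. X i \<in> L2_closure M V" and conv: "L2_conv M X Y F" and F: "F \<noteq> bot"
  shows "Y \<in> L2_closure M V"
proof -
  have Y2: "Y \<in> L2_rv M" and X2: "\<And>i. X i \<in> L2_rv M"
    and lim: "((\<lambda>i. \<integral>\<omega>. (X i \<omega> - Y \<omega>)\<^sup>2 \<partial>M) \<longlongrightarrow> 0) F"
    using conv by (auto simp: L2_conv_def)
  have "\<exists>Z\<in>V \<inter> L2_rv M. (\<integral>\<omega>. (Y \<omega> - Z \<omega>)\<^sup>2 \<partial>M) < \<epsilon>" if \<epsilon>: "\<epsilon> > 0" for \<epsilon>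
  proof -
    have "\<forall>\<^sub>F i in F. (\<integral>\<omega>. (X i \<omega> - Y \<omega>)\<^sup>2 \<partial>M) < \<epsilon> / 4"
      using that by (intro order_tendstoD(2)[OF lim]) simp
    then obtain i where i: "(\<integral>\<omega>. (X i \<omega> - Y \<omega>)\<^sup>2 \<partial>M) < \<epsilon> / 4"
      using F eventually_happens by blast
    obtain Z where Z: "Z \<in> V" "Z \<in> L2_rv M" "(\<integral>\<omega>. (X i \<omega> - Z \<omega>)\<^sup>2 \<partial>M) < \<epsilon> / 4"
      by (rule L2_closureE[OF X[of i], of "\<epsilon> / 4"]) (use \<epsilon> in auto)
    have "(\<integral>\<omega>. (Y \<omega> - Z \<omega>)\<^sup>2 \<partial>M) \<le> 2 * (\<integral>\<omega>. (Y \<omega> - X i \<omega>)\<^sup>2 \<partial>M) + 2 * (\<integral>\<omega>. (X i \<omega> - Z \<omega>)\<^sup>2 \<partial>M)"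
      by (intro L2_dist_triangle X2 Y2 Z)
    also have "\<dots> < \<epsilon>" using i Z by (simp add: power2_commute[of "Y _"])
    finally show ?thesis using Z by blast
  qed
  then show ?thesis using Y2 by (simp add: L2_closure_def)
qed

text \<open>
  Every version of the derivative is covered, so it is irrelevant which one \<open>ms_deriv\<close> selects.
\<close>
lemma ms_deriv_in_L2_closure:
  assumes F: "\<And>y. F y \<in> L2_closure M V" and V: "\<And>X Y. X \<in> V \<Longrightarrow> Y \<in> V \<Longrightarrow> (\<lambda>\<omega>. X \<omega> + Y \<omega>) \<in> V"
    "\<And>a X. X \<in> V \<Longrightarrow> (\<lambda>\<omega>. a * X \<omega>) \<in> V" and G: "has_ms_deriv M F e x G"
  shows "G \<in> L2_closure M V"
proof (rule L2_closure_limit)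
  show "L2_conv M (diff_quot F e x) G (at 0)" using G by (simp add: has_ms_deriv_diff_quot)
  fix t
  have "(\<lambda>\<omega>. inverse t * (F (x + t *\<^sub>R e) \<omega> + (-1) * F x \<omega>)) \<in> L2_closure M V"
    by (intro L2_closure_cmult L2_closure_add V F)
  then show "diff_quot F e x t \<in> L2_closure M V"
    by (simp add: diff_quot_def[abs_def] divide_inverse mult.commute)
qed simp

text \<open>
  Finite linear combinations of a centered Gaussian field are centered Gaussian, and this property
  survives in the closure.
\<close>
lemma (in prob_space) L2_closure_field_span_centered_gaussian:
  assumes u: "gaussian_field M u" "mean_zero_field M u" and X: "X \<in> L2_closure M (field_span u)"
  shows "centered_gaussian M X"
proof -
  note u2 = gaussian_field_L2[OF u(1)]
  have span: "centered_gaussian M Y" if "Y \<in> field_span u" for Y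
  proof -
    from that obtain S c where S: "finite S" "Y = (\<lambda>\<omega>. \<Sum>x\<in>S. c x * u x \<omega>)"
      by (auto simp: field_span_def)
    have "integral\<^sup>L M Y = (\<Sum>x\<in>S. c x * integral\<^sup>L M (u x))"
      unfolding S(2) using integrable_L2[OF u2] by (subst Bochner_Integration.integral_sum) auto
    then have "integral\<^sup>L M Y = 0" using u(2) by (simp add: mean_zero_field_def)
    moreover have "gaussian_rv M Y"
      using u(1) S by (simp add: gaussian_field_def)
    ultimately show ?thesis by (rule gaussian_rv_imp_centered_gaussian[rotated])
  qed
  have "\<forall>n. \<exists>Y\<in>field_span u \<inter> L2_rv M. (\<integral>\<omega>. (X \<omega> - Y \<omega>)\<^sup>2 \<partial>M) < inverse (real (Suc n))"
    using X by (simp add: L2_closure_def)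
  then obtain Y where Y: "\<And>n. Y n \<in> field_span u" "\<And>n. Y n \<in> L2_rv M"
    "\<And>n. (\<integral>\<omega>. (X \<omega> - Y n \<omega>)\<^sup>2 \<partial>M) < inverse (real (Suc n))"
    by (metis IntE)
  have "(\<lambda>n. \<integral>\<omega>. (Y n \<omega> - X \<omega>)\<^sup>2 \<partial>M) \<longlonglongrightarrow> 0"
  proof (rule Lim_null_comparison[OF always_eventually LIMSEQ_inverse_real_of_nat], intro allI)
    show "norm (\<integral>\<omega>. (Y n \<omega> - X \<omega>)\<^sup>2 \<partial>M) \<le> inverse (real (Suc n))" for n
      using Y(3)[of n] by (simp add: power2_commute[of "X _"] less_imp_le)
  qed
  then have "L2_conv M Y X sequentially" using X Y by (simp add: L2_conv_def L2_closure_def)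
  then show ?thesis by (rule centered_gaussian_L2_limit[rotated]) (simp_all add: span Y)
qed


section \<open>The error process\<close>

text \<open>
  By bilinearity, the kernel of the block field is a signed sum of four copies of that of \<open>u\<close>,
  precomposed with coordinate swaps.
\<close>
lemma k_times_cont_diff_block_field:
  fixes u :: "'a::euclidean_space \<times> 'a \<Rightarrow> 'w \<Rightarrow> real"
  assumes u: "\<And>x. u x \<in> L2_rv M" and K: "k_times_cont_diff k (product_moment M u)"
  shows "k_times_cont_diff k (product_moment M (block_field u))"
proof -
  let ?K = "product_moment M u"
  have i: "integrable M (\<lambda>\<omega>. u x \<omega> * u y \<omega>)" for x y by (intro integrable_mult_L2 u)
  have eq: "product_moment M (block_field u) =
    (\<lambda>p. (?K p + - ?K (fst p, prod.swap (snd p))) + (- ?K (prod.swap (fst p), snd p) + ?K (prod.swap (fst p), prod.swap (snd p))))"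
    by (auto simp: fun_eq_iff product_moment_def block_field_def left_diff_distrib right_diff_distrib i)
  have lin: "bounded_linear (\<lambda>p. (fst p, prod.swap (snd p)) :: ('a \<times> 'a) \<times> ('a \<times> 'a))"
    "bounded_linear (\<lambda>p. (prod.swap (fst p), snd p) :: ('a \<times> 'a) \<times> ('a \<times> 'a))"
    "bounded_linear (\<lambda>p. (prod.swap (fst p), prod.swap (snd p)) :: ('a \<times> 'a) \<times> ('a \<times> 'a))"
    by (auto intro!: linearI simp flip: linear_conv_bounded_linear)
  show ?thesis unfolding eq
    by (intro k_times_cont_diff_add k_times_cont_diff_minus K lin[THEN k_times_cont_diff_compose_linear, OF K])
qed

text \<open>
  Each order of mean-square differentiation costs two orders of smoothness of the kernel.  Fourfold
  differentiability therefore gives the first derivatives at every point, as required for them to be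
  differentiated once more, and then the second derivatives.
\<close>
lemma (in prob_space) error_process_in_L2_closure:
  fixes f :: "(real^'d::finite) \<times> (real^'d) \<Rightarrow> 'a \<Rightarrow> real"
  assumes f: "\<And>x. f x \<in> L2_closure M V" and K: "k_times_cont_diff 4 (product_moment M f)"
    and V: "\<And>X Y. X \<in> V \<Longrightarrow> Y \<in> V \<Longrightarrow> (\<lambda>\<omega>. X \<omega> + Y \<omega>) \<in> V"
    "\<And>a X. X \<in> V \<Longrightarrow> (\<lambda>\<omega>. a * X \<omega>) \<in> V"
  shows "error_process M f zs x \<in> L2_closure M V"
proof -
  let ?C = "L2_closure M V"
  have f2: "f x \<in> L2_rv M" for x using f by (simp add: L2_closure_def)
  have K2: "k_times_cont_diff 2 (product_moment M f)"
    using K k_times_cont_diff_Suc_imp by (simp only: eval_nat_numeral BitM.simps) blast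
  have d1: "has_ms_deriv M f e y (ms_deriv M f e y)" for e y
    using ms_deriv_exists[OF f2 K2] has_ms_deriv_ms_deriv by blast
  have C1: "ms_deriv M f e y \<in> ?C" for e y
    by (rule ms_deriv_in_L2_closure[OF f V d1])
  have d2: "has_ms_deriv M (ms_deriv M f e) e' y (ms_deriv M (ms_deriv M f e) e' y)" for e e' y
  proof -
    have "k_times_cont_diff 2 (mixed_deriv e (product_moment M f))"
      using K unfolding mixed_deriv_def[abs_def]
      by (simp only: eval_nat_numeral BitM.simps k_times_cont_diff.simps) blast
    then have "k_times_cont_diff 2 (product_moment M (ms_deriv M f e))"
      using product_moment_ms_deriv[OF K2 d1] by simp
    moreover have "ms_deriv M f e y \<in> L2_rv M" for y using C1 by (simp add: L2_closure_def)
    ultimately show ?thesis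
      using ms_deriv_exists has_ms_deriv_ms_deriv by blast
  qed
  have C2: "ms_deriv M (ms_deriv M f e) e' y \<in> ?C" for e e' y
    by (rule ms_deriv_in_L2_closure[OF C1 V d2])
  have mult: "(\<lambda>\<omega>. a * X \<omega>) \<in> ?C" if "X \<in> ?C" for a X
    by (rule L2_closure_cmult[OF V(2) that])
  have add: "(\<lambda>\<omega>. X \<omega> + Y \<omega>) \<in> ?C" if "X \<in> ?C" "Y \<in> ?C" for X Y
    by (rule L2_closure_add[OF V(1) that])
  have diff: "(\<lambda>\<omega>. X \<omega> - Y \<omega>) \<in> ?C" if "X \<in> ?C" "Y \<in> ?C" for X Y
    using add[OF that(1) mult[OF that(2), of "-1"]] by simp
  have zero: "(\<lambda>\<omega>. 0) \<in> ?C" using mult[OF f, of 0 undefined] by simp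
  have sum: "(\<lambda>\<omega>. \<Sum>i\<in>I. X i \<omega>) \<in> ?C" if "\<And>i. X i \<in> ?C" for X :: "'d \<Rightarrow> 'a \<Rightarrow> real" and I
    by (induction I rule: infinite_finite_induct) (auto intro: zero add that)
  have form: "(\<lambda>\<omega>. a \<bullet> (H \<omega> *v b)) \<in> ?C" if H: "\<And>i j. (\<lambda>\<omega>. H \<omega> $ i $ j) \<in> ?C"
    for H :: "'a \<Rightarrow> real^'d^'d" and a b
  proof -
    have "(\<lambda>\<omega>. \<Sum>i\<in>UNIV. a $ i * (\<Sum>j\<in>UNIV. b $ j * H \<omega> $ i $ j)) \<in> ?C"
      by (intro sum mult H)
    then show ?thesis by (simp add: inner_vec_def matrix_vector_mult_def mult.commute)
  qed
  have grad: "(\<lambda>\<omega>. taylor_grad M f zs \<omega> \<bullet> a) \<in> ?C" for a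
  proof -
    have "(\<lambda>\<omega>. \<Sum>i\<in>UNIV. a $ i * ms_deriv M f (dir1 i) (zs, zs) \<omega>) \<in> ?C"
      by (intro sum mult C1)
    then show ?thesis by (simp add: inner_vec_def taylor_grad_def mult.commute)
  qed
  have H: "(\<lambda>\<omega>. taylor_H11 M f zs \<omega> $ i $ j) \<in> ?C" "(\<lambda>\<omega>. taylor_H12 M f zs \<omega> $ i $ j) \<in> ?C" for i j
    using C2 by (simp_all add: taylor_H11_def taylor_H12_def)
  show ?thesis
    unfolding error_process_def[abs_def] taylor2_def[abs_def] Let_def
    by (intro diff add mult grad form H f)
qed

theorem proposition31:
  fixes M :: "'w measure"
    and u :: "(real^'d::finite) \<times> (real^'d) \<Rightarrow> 'w \<Rightarrow> real"
    and h :: "real \<Rightarrow> real"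
    and zs x1 x2 :: "real^'d"
    and p :: real
  assumes "prob_space M"
    and "gaussian_field M u"
    and "mean_zero_field M u"
    and "\<And>x y. cov_fun M u (x, y) = h ((norm (x - y))\<^sup>2)"
    and "k_times_cont_diff 4 (cov_fun M u)"
    and "C2_on_nonneg h"
    and "0 < p" and "p < 1"
  shows "error_bound M p (error_process M (block_field u) zs (x1, x2))
         = std_dev M (error_process M (block_field u) zs (x1, x2))
           * quantile_function std_normal_distribution p"
proof -
  interpret prob_space M by (rule assms)
  note V = field_span_add[of _ u] field_span_cmult[of _ u]
  note u2 = gaussian_field_L2[OF assms(2)]
  have "cov_fun M u = product_moment M u"
    using assms(3) by (auto simp: fun_eq_iff cov_fun_def product_moment_def mean_zero_field_def)
  then have K: "k_times_cont_diff 4 (product_moment M (block_field u))"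
    using assms(5) by (intro k_times_cont_diff_block_field u2) simp
  have "block_field u x \<in> L2_closure M (field_span u)" for x
  proof -
    have "(\<lambda>\<omega>. u x \<omega> + (-1) * u (prod.swap x) \<omega>) \<in> L2_closure M (field_span u)"
      by (intro L2_closure_add L2_closure_cmult L2_closure_superset V field_in_span u2)
    then show ?thesis by (simp add: block_field_def[abs_def])
  qed
  then have "error_process M (block_field u) zs (x1, x2) \<in> L2_closure M (field_span u)"
    by (intro error_process_in_L2_closure K V)
  then have "centered_gaussian M (error_process M (block_field u) zs (x1, x2))"
    by (rule L2_closure_field_span_centered_gaussian[OF assms(2,3)])
  then show ?thesis by (rule error_bound_centered_gaussian[OF _ assms(7,8)])
qed

end
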